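(* Let $1\le N\le 4$, let $f\in C^1(\mathbb{R})$ satisfy $f\ge 0$, and let $u\in C^2(\mathbb{R}^N)$ be a bounded, stable solution of $-\Delta u=f(u)$ in $\mathbb{R}^N$. Then $u$ is constant.
   Context: A solution $u\in C^2(\mathbb{R}^N)$ of $-\Delta u=f(u)$ in $\mathbb{R}^N$ is called stable if for all $\varphi\in C^1_c(\mathbb{R}^N)$, $\int_{\mathbb{R}^N} f'(u)\varphi^2\,dx\le\int_{\mathbb{R}^N}|\nabla\varphi|^2\,dx$. *)

theory Defs
  imports "HOL-Analysis.Analysis"
begin

definition partial_deriv :: "'n \<Rightarrow> (real ^ 'n \<Rightarrow> real) \<Rightarrow> real ^ 'n \<Rightarrow> real"
  where "partial_deriv i g x = frechet_derivative g (at x) (axis i 1)"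

(* The class C^k(R^N). Only differentiable functions have a meaningful
   frechet_derivative, so differentiability is demanded at every order below k. *)
fun Ck :: "nat \<Rightarrow> (real ^ 'n \<Rightarrow> real) \<Rightarrow> bool"
  where
    "Ck 0 g \<longleftrightarrow> continuous_on UNIV g"
  | "Ck (Suc k) g \<longleftrightarrow> (\<forall>x. g differentiable (at x)) \<and> (\<forall>i. Ck k (partial_deriv i g))"

definition gradient :: "(real ^ 'n \<Rightarrow> real) \<Rightarrow> real ^ 'n \<Rightarrow> real ^ 'n"
  where "gradient g x = (\<chi> i. partial_deriv i g x)"

definition laplacian :: "(real ^ 'n \<Rightarrow> real) \<Rightarrow> real ^ 'n \<Rightarrow> real"
  where "laplacian g x = (\<Sum>i\<in>UNIV. partial_deriv i (partial_deriv i g) x)"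

definition C1_compact_support :: "(real ^ 'n \<Rightarrow> real) \<Rightarrow> bool"
  where "C1_compact_support g \<longleftrightarrow> Ck 1 g \<and> compact (closure (support_on UNIV g))"

definition solution :: "(real \<Rightarrow> real) \<Rightarrow> (real ^ 'n \<Rightarrow> real) \<Rightarrow> bool"
  where "solution f u \<longleftrightarrow> Ck 2 u \<and> (\<forall>x. - laplacian u x = f (u x))"

(* For f of class C^1 and u continuous, both integrands are continuous with compact
   support, so the Bochner integrals never take their default value for
   non-integrable functions. *)
definition stable_solution :: "(real \<Rightarrow> real) \<Rightarrow> (real ^ 'n \<Rightarrow> real) \<Rightarrow> bool"
  where "stable_solution f u \<longleftrightarrow> solution f u \<and>
    (\<forall>\<phi>. C1_compact_support \<phi> \<longrightarrow>
      (LINT x|lborel. deriv f (u x) * (\<phi> x)\<^sup>2) \<le> (LINT x|lborel. (norm (gradient \<phi> x))\<^sup>2))"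

end

theory Submission
  imports Defs
begin

text \<open>
  Testing stability with \<open>sqrt(|\<nabla>u|\<^sup>2 + \<epsilon>) \<eta>\<close>, testing the linearized equation with \<open>\<partial>\<^sub>iu \<eta>\<^sup>2\<close>, and
  letting \<open>\<epsilon> \<rightarrow> 0\<close> gives the Sternberg-Zumbrun inequality, which bounds the integral of
  \<open>(|D\<^sup>2u|\<^sup>2 - |\<nabla>|\<nabla>u||\<^sup>2) \<eta>\<^sup>2\<close> by that of \<open>|\<nabla>u|\<^sup>2 |\<nabla>\<eta>|\<^sup>2\<close>. Since \<open>u\<close> is bounded and superharmonic,
  the energy of \<open>u\<close> in a ball of radius \<open>R\<close> is at most \<open>C R\<^bsup>N-2\<^esup> \<le> C R\<^sup>2\<close>, so the right-hand side tends
  to zero for averages \<open>\<eta>\<close> of cutoffs at \<open>L\<close> consecutive dyadic scales. Hence \<open>D\<^sup>2u\<close> has rank one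
  wherever \<open>\<nabla>u \<noteq> 0\<close>: there \<open>\<nabla>u\<close> has locally constant direction, and superharmonicity makes its
  length nondecreasing backwards along that direction. If \<open>\<nabla>u\<close> were nonzero somewhere, \<open>u\<close> would
  therefore be unbounded below along a half-line.
\<close>

section \<open>Integrals of continuous functions with compact support\<close>

lemma integrable_lborel_compact_support:
  fixes g :: "'a::euclidean_space \<Rightarrow> real"
  assumes "continuous_on UNIV g" "\<And>x. norm x > R \<Longrightarrow> g x = 0"
  shows "integrable lborel g"
proof -
  have "integrable lborel (\<lambda>x. indicator (cball 0 R) x *\<^sub>R g x)"
    by (rule borel_integrable_compact) (auto intro: continuous_on_subset[OF assms(1)])
  moreover have "(\<lambda>x. indicator (cball 0 R) x *\<^sub>R g x) = g"
    using assms(2) by (auto simp: fun_eq_iff indicator_def not_le)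
  ultimately show ?thesis by simp
qed

text \<open>The Leibniz rule differentiates integrals over a box, while the rest is stated with
  \<open>lborel\<close>; this passes between the two.\<close>

lemma integral_cbox_compact_support:
  fixes g :: "'a::euclidean_space \<Rightarrow> real"
  assumes "continuous_on UNIV g" "\<And>x. norm x > R \<Longrightarrow> g x = 0" "cball 0 R \<subseteq> cbox a b"
  shows "integral (cbox a b) g = (LINT x|lborel. g x)"
proof -
  have "g x = 0" if "x \<notin> cbox a b" for x
    using that assms(2)[of x] assms(3) by (auto simp: subset_iff not_le[symmetric])
  then have "(\<lambda>x. if x \<in> cbox a b then g x else 0) = g"
    by (auto simp: fun_eq_iff)
  then show ?thesis
    using integral_restrict_UNIV[of "cbox a b" g]
      integral_lborel[OF integrable_lborel_compact_support[OF assms(1,2)]] by simp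
qed

lemma lborel_integral_translate:
  fixes g :: "'a::euclidean_space \<Rightarrow> real"
  assumes "g \<in> borel_measurable borel"
  shows "(LINT x|lborel. g (x + c)) = (LINT x|lborel. g x)"
proof -
  have "(LINT x|lborel. g x) = (LINT x|distr lborel borel ((+) c). g x)"
    by (simp add: lborel_distr_plus)
  also have "\<dots> = (LINT x|lborel. g (c + x))"
    by (rule integral_distr) (use assms in auto)
  finally show ?thesis by (simp add: add.commute)
qed

text \<open>For \<open>|t| < 1\<close> all supports lie in one box, so the Leibniz rule identifies
  the integral of \<open>k' 0\<close> with the derivative of the constant \<open>c\<close>. Both
  integration by parts and the linearization below come from it, with a translation as the
  parameter.\<close>

lemma integral_derivative_eq_0:
  fixes k k' :: "real \<Rightarrow> 'a::euclidean_space \<Rightarrow> real"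
  assumes der: "\<And>t x. ((\<lambda>t. k t x) has_real_derivative k' t x) (at t)"
    and cont: "\<And>t. continuous_on UNIV (k t)"
    and cont': "continuous_on UNIV (\<lambda>(t, x). k' t x)"
    and supp: "\<And>t x. \<bar>t\<bar> < 1 \<Longrightarrow> norm x > R \<Longrightarrow> k t x = 0"
    and const: "\<And>t. (LINT x|lborel. k t x) = c"
  shows "(LINT x|lborel. k' 0 x) = 0"
proof -
  obtain a b where ab: "cball (0::'a) R \<subseteq> cbox a b"
    using bounded_subset_cbox_symmetric[OF bounded_cball] by blast
  \<comment> \<open>Outside the ball \<open>k t x\<close> vanishes for all \<open>t\<close> near 0,
    hence so does its derivative in \<open>t\<close> at 0.\<close>
  have supp': "k' 0 x = 0" if "norm x > R" for x
  proof (rule DERIV_unique)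
    show "((\<lambda>t. k t x) has_real_derivative k' 0 x) (at 0)" by (rule der)
    have "((\<lambda>t. 0) has_real_derivative 0) (at (0::real))" by simp
    then show "((\<lambda>t. k t x) has_real_derivative 0) (at 0)"
      by (rule has_field_derivative_transform_within_open[where S="{-1<..<1}"])
        (use supp that in \<open>auto simp: abs_less_iff\<close>)
  qed
  have c0: "continuous_on UNIV (k' 0)"
    using continuous_on_compose2[OF cont' continuous_on_Pair[OF continuous_on_const[of UNIV 0] continuous_on_id]]
    by simp
  have "((\<lambda>t. integral (cbox a b) (k t)) has_real_derivative integral (cbox a b) (k' 0))
      (at 0 within {-1<..<1})"
  proof (rule leibniz_rule_field_derivative)
    show "((\<lambda>t. k t x) has_real_derivative k' t x) (at t within {-1<..<1})" for t x
      by (rule has_field_derivative_at_within[OF der])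
    show "k t integrable_on cbox a b" for t
      by (rule integrable_continuous[OF continuous_on_subset[OF cont subset_UNIV]])
    show "continuous_on ({-1<..<1} \<times> cbox a b) (\<lambda>(t, x). k' t x)"
      by (rule continuous_on_subset[OF cont' subset_UNIV])
  qed auto
  then have "((\<lambda>t. integral (cbox a b) (k t)) has_real_derivative integral (cbox a b) (k' 0)) (at 0)"
    by (subst (asm) at_within_open) auto
  moreover have "((\<lambda>t. integral (cbox a b) (k t)) has_real_derivative 0) (at 0)"
  proof (rule has_field_derivative_transform_within_open[where S="{-1<..<1}"])
    show "((\<lambda>t. c) has_real_derivative 0) (at 0)" by simp
    show "c = integral (cbox a b) (k t)" if "t \<in> {-1<..<1}" for t
      using integral_cbox_compact_support[OF cont[of t] _ ab] supp[of t] that const[of t]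
      by (auto simp: abs_less_iff)
  qed auto
  ultimately have "integral (cbox a b) (k' 0) = 0"
    by (rule DERIV_unique)
  then show ?thesis
    using integral_cbox_compact_support[OF c0 supp' ab] by simp
qed

section \<open>Calculus of C^1 functions with explicit gradients\<close>

text \<open>With the gradient as an argument, gradients of sums, products and compositions are built
  by the rules below rather than extracted from \<open>frechet_derivative\<close>.\<close>

definition C1_grad :: "('a::euclidean_space \<Rightarrow> real) \<Rightarrow> ('a \<Rightarrow> 'a) \<Rightarrow> bool"
  where "C1_grad g G \<longleftrightarrow> (\<forall>x. (g has_derivative (\<lambda>h. G x \<bullet> h)) (at x)) \<and> continuous_on UNIV G"

lemma C1_grad_cont: "C1_grad g G \<Longrightarrow> continuous_on UNIV g"
  unfolding C1_grad_def
  by (meson continuous_at_imp_continuous_on has_derivative_continuous)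

lemma C1_grad_cont': "C1_grad g G \<Longrightarrow> continuous_on UNIV G"
  by (simp add: C1_grad_def)

lemma C1_grad_deriv: "C1_grad g G \<Longrightarrow> (g has_derivative (\<lambda>h. G x \<bullet> h)) (at x)"
  by (simp add: C1_grad_def)

lemma C1_grad_line:
  assumes "C1_grad g G"
  shows "((\<lambda>t. g (x + t *\<^sub>R e)) has_real_derivative G (x + t *\<^sub>R e) \<bullet> e) (at t)"
  unfolding has_field_derivative_def
  by (rule has_derivative_eq_rhs[OF has_derivative_compose[OF _ C1_grad_deriv[OF assms]]])
    (auto intro!: derivative_eq_intros simp: fun_eq_iff)

lemma C1_grad_mult:
  assumes "C1_grad g G" "C1_grad h H"
  shows "C1_grad (\<lambda>x. g x * h x) (\<lambda>x. g x *\<^sub>R H x + h x *\<^sub>R G x)"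
  unfolding C1_grad_def
proof (intro conjI allI)
  show "continuous_on UNIV (\<lambda>x. g x *\<^sub>R H x + h x *\<^sub>R G x)"
    by (intro continuous_intros C1_grad_cont[OF assms(1)] C1_grad_cont[OF assms(2)]
        C1_grad_cont'[OF assms(1)] C1_grad_cont'[OF assms(2)])
  show "((\<lambda>x. g x * h x) has_derivative (\<lambda>k. (g x *\<^sub>R H x + h x *\<^sub>R G x) \<bullet> k)) (at x)" for x
    by (rule derivative_eq_intros C1_grad_deriv[OF assms(1)] C1_grad_deriv[OF assms(2)] refl)+
      (simp add: algebra_simps inner_add_left)
qed

lemma C1_grad_const: "C1_grad (\<lambda>x. c) (\<lambda>x. 0)"
  by (simp add: C1_grad_def)

lemma C1_grad_add:
  assumes "C1_grad g G" "C1_grad h H"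
  shows "C1_grad (\<lambda>x. g x + h x) (\<lambda>x. G x + H x)"
  using assms by (auto simp: C1_grad_def inner_add_left intro!: continuous_intros has_derivative_add)

lemma C1_grad_sum:
  assumes "\<And>i. i \<in> I \<Longrightarrow> C1_grad (g i) (G i)"
  shows "C1_grad (\<lambda>x. \<Sum>i\<in>I. g i x) (\<lambda>x. \<Sum>i\<in>I. G i x)"
  using assms by (auto simp: C1_grad_def inner_sum_left intro!: continuous_intros has_derivative_sum)

text \<open>The outer function is differentiated only at values taken by \<open>g\<close>, so that
  \<open>sqrt\<close> may be composed with a positive function.\<close>

lemma C1_grad_compose:
  assumes g: "C1_grad g G"
    and \<phi>: "\<And>x. (\<phi> has_real_derivative \<phi>' (g x)) (at (g x))"
    and cont: "continuous_on UNIV (\<lambda>x. \<phi>' (g x))"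
  shows "C1_grad (\<lambda>x. \<phi> (g x)) (\<lambda>x. \<phi>' (g x) *\<^sub>R G x)"
  unfolding C1_grad_def
proof (intro conjI allI)
  show "continuous_on UNIV (\<lambda>x. \<phi>' (g x) *\<^sub>R G x)"
    by (intro continuous_intros C1_grad_cont'[OF g] cont)
  show "((\<lambda>x. \<phi> (g x)) has_derivative (\<lambda>h. (\<phi>' (g x) *\<^sub>R G x) \<bullet> h)) (at x)" for x
    using has_derivative_compose[OF C1_grad_deriv[OF g] \<phi>[of x, unfolded has_field_derivative_def]]
    by simp
qed

lemma C1_grad_support:
  assumes g: "C1_grad g G" and "\<And>x. norm x > R \<Longrightarrow> g x = 0" and "norm x > R"
  shows "G x = 0"
proof -
  have "(g has_derivative (\<lambda>h. 0)) (at x)"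
  proof (rule has_derivative_transform_within_open[where s="- cball 0 R"])
    show "((\<lambda>x. 0) has_derivative (\<lambda>h. 0)) (at x)" by simp
  qed (use assms in auto)
  then have "(\<lambda>h. G x \<bullet> h) = (\<lambda>h. 0)"
    by (rule has_derivative_unique[OF C1_grad_deriv[OF g]])
  then show ?thesis by (metis inner_eq_zero_iff)
qed

text \<open>By translation invariance the integral of \<open>g (x + t *\<^sub>R e)\<close> does not
  depend on \<open>t\<close>; differentiate at \<open>t = 0\<close>. Applied to products this is
  integration by parts without boundary terms.\<close>

lemma integral_gradient_eq_0:
  fixes g :: "'a::euclidean_space \<Rightarrow> real"
  assumes g: "C1_grad g G" and supp: "\<And>x. norm x > R \<Longrightarrow> g x = 0"
  shows "(LINT x|lborel. G x \<bullet> e) = 0"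
proof -
  note [continuous_intros] = continuous_on_compose2[OF C1_grad_cont[OF g]]
    continuous_on_compose2[OF C1_grad_cont'[OF g]]
  have meas: "g \<in> borel_measurable borel"
    using C1_grad_cont[OF g] by (rule borel_measurable_continuous_onI)
  have "(LINT x|lborel. G (x + 0 *\<^sub>R e) \<bullet> e) = 0"
  \<comment> \<open>Shifts with \<open>|t| < 1\<close> move the support by at most
    \<open>norm e\<close>, whence the enlarged radius.\<close>
  proof (rule integral_derivative_eq_0[where k="\<lambda>t x. g (x + t *\<^sub>R e)" and R="R + norm e"
        and c="LINT x|lborel. g x"])
    show "((\<lambda>t. g (x + t *\<^sub>R e)) has_real_derivative G (x + t *\<^sub>R e) \<bullet> e) (at t)" for t x
      by (rule C1_grad_line[OF g])
    show "continuous_on UNIV (\<lambda>x. g (x + t *\<^sub>R e))" for t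
      by (intro continuous_intros) auto
    show "continuous_on UNIV (\<lambda>(t, x). G (x + t *\<^sub>R e) \<bullet> e)"
      unfolding case_prod_beta by (intro continuous_intros) auto
    show "(LINT x|lborel. g (x + t *\<^sub>R e)) = (LINT x|lborel. g x)" for t
      by (rule lborel_integral_translate[OF meas])
    show "g (x + t *\<^sub>R e) = 0" if "\<bar>t\<bar> < 1" "norm x > R + norm e" for t x
    proof (rule supp)
      have "norm (t *\<^sub>R e) \<le> norm e" using that by (simp add: mult_left_le_one_le)
      moreover have "norm x \<le> norm (x + t *\<^sub>R e) + norm (t *\<^sub>R e)"
        by (metis add_diff_cancel norm_triangle_ineq4)
      ultimately show "R < norm (x + t *\<^sub>R e)" using that by linarith
    qed
  qed
  then show ?thesis by simp
qed

lemma C1_grad_translate: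
  assumes "C1_grad g G"
  shows "C1_grad (\<lambda>x. g (x + c)) (\<lambda>x. G (x + c))"
  unfolding C1_grad_def
proof (intro conjI allI)
  show "continuous_on UNIV (\<lambda>x. G (x + c))"
    by (intro continuous_on_compose2[OF C1_grad_cont'[OF assms]] continuous_intros) auto
  show "((\<lambda>x. g (x + c)) has_derivative (\<lambda>h. G (x + c) \<bullet> h)) (at x)" for x
    by (rule has_derivative_eq_rhs[OF has_derivative_compose[OF _ C1_grad_deriv[OF assms]]])
      (auto intro!: derivative_eq_intros)
qed

section \<open>Symmetry of second derivatives\<close>

text \<open>The mean value theorem is applied twice: along \<open>e\<close> to the increment of
  \<open>u\<close> by \<open>h *\<^sub>R d\<close>, then along \<open>d\<close> to the resulting
  difference of \<open>U \<bullet> e\<close>.\<close>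

lemma second_difference:
  fixes x :: "'a::euclidean_space"
  assumes u: "C1_grad u U" and A: "C1_grad (\<lambda>x. U x \<bullet> e) A" and h: "h > 0"
  obtains s t where "0 < s" "s < h" "0 < t" "t < h"
    "u (x + h *\<^sub>R e + h *\<^sub>R d) - u (x + h *\<^sub>R e) - u (x + h *\<^sub>R d) + u x
      = h * h * (A (x + s *\<^sub>R e + t *\<^sub>R d) \<bullet> d)"
proof -
  have "\<exists>s>0. s < h \<and> (u (x + h *\<^sub>R d + h *\<^sub>R e) - u (x + h *\<^sub>R e))
      - (u (x + h *\<^sub>R d + 0 *\<^sub>R e) - u (x + 0 *\<^sub>R e))
      = (h - 0) * (U (x + h *\<^sub>R d + s *\<^sub>R e) \<bullet> e - U (x + s *\<^sub>R e) \<bullet> e)"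
    by (rule MVT2[OF h]) (intro DERIV_diff C1_grad_line[OF u])
  then obtain s where s: "0 < s" "s < h"
    and es: "u (x + h *\<^sub>R d + h *\<^sub>R e) - u (x + h *\<^sub>R e) - (u (x + h *\<^sub>R d) - u x)
      = h * (U (x + h *\<^sub>R d + s *\<^sub>R e) \<bullet> e - U (x + s *\<^sub>R e) \<bullet> e)"
    by auto
  have "\<exists>t>0. t < h \<and> U (x + s *\<^sub>R e + h *\<^sub>R d) \<bullet> e - U (x + s *\<^sub>R e + 0 *\<^sub>R d) \<bullet> e
      = (h - 0) * (A (x + s *\<^sub>R e + t *\<^sub>R d) \<bullet> d)"
    by (rule MVT2[OF h]) (intro C1_grad_line[OF A])
  then obtain t where t: "0 < t" "t < h"
    and et: "U (x + s *\<^sub>R e + h *\<^sub>R d) \<bullet> e - U (x + s *\<^sub>R e) \<bullet> e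
      = h * (A (x + s *\<^sub>R e + t *\<^sub>R d) \<bullet> d)"
    by auto
  show ?thesis
    using es et by (intro that[OF s t]) (simp add: add_ac)
qed

text \<open>Schwarz's theorem: the second difference is symmetric in \<open>d\<close> and
  \<open>e\<close>, so the two mixed derivatives agree at two points close to \<open>x\<close>, and
  continuity carries this to \<open>x\<close>.\<close>

lemma mixed_derivatives_eq:
  fixes x :: "'a::euclidean_space"
  assumes u: "C1_grad u U" and A: "C1_grad (\<lambda>x. U x \<bullet> e) A" and B: "C1_grad (\<lambda>x. U x \<bullet> d) B"
  shows "A x \<bullet> d = B x \<bullet> e"
proof (rule ccontr)
  define \<epsilon> where "\<epsilon> = \<bar>A x \<bullet> d - B x \<bullet> e\<bar> / 2"
  assume "A x \<bullet> d \<noteq> B x \<bullet> e"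
  then have \<epsilon>: "\<epsilon> > 0" by (simp add: \<epsilon>_def)
  have "continuous (at x) (\<lambda>y. A y \<bullet> d)" "continuous (at x) (\<lambda>y. B y \<bullet> e)"
    using C1_grad_cont'[OF A] C1_grad_cont'[OF B]
    by (auto intro!: continuous_intros simp: continuous_on_eq_continuous_at)
  then obtain \<delta>1 \<delta>2 where \<delta>: "\<delta>1 > 0" "\<delta>2 > 0"
    and A': "\<And>y. dist y x < \<delta>1 \<Longrightarrow> \<bar>A y \<bullet> d - A x \<bullet> d\<bar> < \<epsilon>"
    and B': "\<And>y. dist y x < \<delta>2 \<Longrightarrow> \<bar>B y \<bullet> e - B x \<bullet> e\<bar> < \<epsilon>"
    using \<epsilon> unfolding continuous_at_eps_delta dist_real_def by metis
  \<comment> \<open>This \<open>h\<close> keeps both intermediate points within both radii of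
    continuity; the \<open>+ 1\<close> keeps the denominator positive.\<close>
  define h where "h = min \<delta>1 \<delta>2 / (norm d + norm e + 1)"
  have pos: "norm d + norm e + 1 > 0"
    by (metis add.commute add_nonneg_pos norm_ge_zero zero_less_one add_nonneg_nonneg)
  have h: "h > 0" using \<delta> pos by (simp add: h_def)
  have near: "norm (s *\<^sub>R a + t *\<^sub>R b) < min \<delta>1 \<delta>2"
    if "0 < s" "s < h" "0 < t" "t < h" "norm a + norm b = norm d + norm e" for s t and a b :: 'a
  proof -
    have "norm (s *\<^sub>R a + t *\<^sub>R b) \<le> s * norm a + t * norm b"
      using that norm_triangle_ineq[of "s *\<^sub>R a" "t *\<^sub>R b"] by simp
    also have "\<dots> \<le> h * norm a + h * norm b"
      using that by (intro add_mono mult_right_mono) auto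
    also have "\<dots> = h * (norm d + norm e)"
      using that(5) by (simp flip: distrib_left)
    also have "\<dots> < h * (norm d + norm e + 1)" using h by simp
    also have "\<dots> = min \<delta>1 \<delta>2" using pos by (simp add: h_def)
    finally show ?thesis .
  qed
  obtain s t where st: "0 < s" "s < h" "0 < t" "t < h"
    and est: "u (x + h *\<^sub>R e + h *\<^sub>R d) - u (x + h *\<^sub>R e) - u (x + h *\<^sub>R d) + u x
      = h * h * (A (x + s *\<^sub>R e + t *\<^sub>R d) \<bullet> d)"
    by (rule second_difference[OF u A h])
  obtain s' t' where st': "0 < s'" "s' < h" "0 < t'" "t' < h"
    and est': "u (x + h *\<^sub>R d + h *\<^sub>R e) - u (x + h *\<^sub>R d) - u (x + h *\<^sub>R e) + u x
      = h * h * (B (x + s' *\<^sub>R d + t' *\<^sub>R e) \<bullet> e)"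
    by (rule second_difference[OF u B h])
  have "h * h * (A (x + s *\<^sub>R e + t *\<^sub>R d) \<bullet> d) = h * h * (B (x + s' *\<^sub>R d + t' *\<^sub>R e) \<bullet> e)"
  proof -
    have "x + h *\<^sub>R d + h *\<^sub>R e = x + h *\<^sub>R e + h *\<^sub>R d" by (simp add: add_ac)
    then have "u (x + h *\<^sub>R d + h *\<^sub>R e) = u (x + h *\<^sub>R e + h *\<^sub>R d)" by (rule arg_cong)
    then show ?thesis using est est' by linarith
  qed
  then have eq: "A (x + s *\<^sub>R e + t *\<^sub>R d) \<bullet> d = B (x + s' *\<^sub>R d + t' *\<^sub>R e) \<bullet> e"
    using h by simp
  have "\<bar>A (x + s *\<^sub>R e + t *\<^sub>R d) \<bullet> d - A x \<bullet> d\<bar> < \<epsilon>"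
    using near[OF st, of e d] by (intro A') (simp add: dist_norm add_ac)
  moreover have "\<bar>B (x + s' *\<^sub>R d + t' *\<^sub>R e) \<bullet> e - B x \<bullet> e\<bar> < \<epsilon>"
    using near[OF st', of d e] by (intro B') (simp add: dist_norm add_ac)
  ultimately show False unfolding eq \<epsilon>_def by argo
qed

section \<open>Translation between \<open>Ck 1\<close> and explicit gradients\<close>

lemma Ck_1_imp_C1_grad:
  assumes "Ck 1 g"
  shows "C1_grad g (gradient g)"
proof -
  have d: "\<And>x. g differentiable (at x)" and c: "\<And>i. continuous_on UNIV (partial_deriv i g)"
    using assms by (auto simp: One_nat_def)
  have "(g has_derivative (\<lambda>h. gradient g x \<bullet> h)) (at x)" for x
  proof -
    have D: "(g has_derivative frechet_derivative g (at x)) (at x)"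
      using d frechet_derivative_works by blast
    have lin: "linear (frechet_derivative g (at x))"
      using D has_derivative_linear by blast
    have "frechet_derivative g (at x) h = gradient g x \<bullet> h" for h
    proof -
      have "frechet_derivative g (at x) h = frechet_derivative g (at x) (\<Sum>i\<in>UNIV. h $ i *\<^sub>R axis i 1)"
        by (simp add: basis_expansion flip: scalar_mult_eq_scaleR)
      also have "\<dots> = (\<Sum>i\<in>UNIV. h $ i * partial_deriv i g x)"
        by (simp add: linear_sum[OF lin] linear_scale[OF lin] partial_deriv_def)
      finally show ?thesis by (simp add: gradient_def inner_vec_def mult.commute)
    qed
    then show ?thesis using D by presburger
  qed
  moreover have "continuous_on UNIV (gradient g)"
    unfolding gradient_def[abs_def] by (intro continuous_on_vec_lambda c)
  ultimately show ?thesis by (simp add: C1_grad_def)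
qed

lemma C1_grad_gradient:
  assumes "C1_grad g G"
  shows "gradient g = G"
proof
  fix x
  have "frechet_derivative g (at x) = (\<lambda>h. G x \<bullet> h)"
    by (rule frechet_derivative_at[OF C1_grad_deriv[OF assms], symmetric])
  then show "gradient g x = G x"
    by (simp add: gradient_def partial_deriv_def vec_eq_iff inner_axis)
qed

lemma C1_grad_imp_Ck_1:
  assumes "C1_grad g G"
  shows "Ck 1 g"
proof -
  have "partial_deriv i g = (\<lambda>x. G x $ i)" for i
    using C1_grad_gradient[OF assms] by (auto simp: gradient_def fun_eq_iff vec_eq_iff)
  moreover have "g differentiable (at x)" for x
    using C1_grad_deriv[OF assms] differentiable_def by blast
  ultimately show ?thesis
    using C1_grad_cont'[OF assms] by (auto simp: One_nat_def intro!: continuous_intros)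
qed

lemma C1_compact_supportI:
  assumes "C1_grad g G" "\<And>x. norm x > R \<Longrightarrow> g x = 0"
  shows "C1_compact_support g"
proof -
  have "support_on UNIV g \<subseteq> cball 0 R"
    using assms(2) by (auto simp: support_on_def not_less[symmetric])
  then have "bounded (support_on UNIV g)"
    using bounded_subset bounded_cball by blast
  then show ?thesis
    using C1_grad_imp_Ck_1[OF assms(1)] by (simp add: C1_compact_support_def)
qed

section \<open>Weak form, linearization and energy of a semilinear equation\<close>

text \<open>\<open>U\<close> is the gradient of \<open>u\<close> and \<open>A i\<close> the
  \<open>i\<close>-th row of its Hessian, so \<open>pde\<close> is the equation with the Laplacian
  written as a trace.\<close>

locale semilinear =
  fixes f f' :: "real \<Rightarrow> real" and u :: "real^'n \<Rightarrow> real"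
    and U :: "real^'n \<Rightarrow> real^'n" and A :: "'n \<Rightarrow> real^'n \<Rightarrow> real^'n"
  assumes f_deriv: "\<And>t. (f has_real_derivative f' t) (at t)"
    and f'_cont: "continuous_on UNIV f'"
    and u_C1: "C1_grad u U"
    and U_C1: "\<And>i. C1_grad (\<lambda>x. U x $ i) (A i)"
    and pde: "\<And>x. (\<Sum>i\<in>UNIV. A i x $ i) = - f (u x)"
begin

lemma f_cont: "continuous_on UNIV f"
  using f_deriv by (meson DERIV_isCont continuous_at_imp_continuous_on)

lemmas cont [continuous_intros] =
  continuous_on_compose2[OF f_cont _ subset_UNIV] continuous_on_compose2[OF f'_cont _ subset_UNIV]
  continuous_on_compose2[OF C1_grad_cont[OF u_C1] _ subset_UNIV]
  continuous_on_compose2[OF C1_grad_cont'[OF u_C1] _ subset_UNIV]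
  continuous_on_compose2[OF C1_grad_cont'[OF U_C1] _ subset_UNIV]

lemma hessian_symmetric: "A i x $ j = A j x $ i"
proof -
  have *: "C1_grad (\<lambda>x. U x \<bullet> axis i 1) (A i)" for i
    using U_C1[of i] by (simp add: inner_axis)
  show ?thesis
    using mixed_derivatives_eq[OF u_C1 * *, of i x j] by (simp add: inner_axis)
qed

text \<open>The function \<open>k i\<close> in the proof is the \<open>i\<close>-th partial
  derivative of \<open>U x $ i * \<psi> x\<close>, hence integrates to zero; summing over
  \<open>i\<close> brings in the trace of the Hessian.\<close>

lemma weak_equation:
  assumes \<psi>: "C1_grad \<psi> P" and supp: "\<And>x. norm x > R \<Longrightarrow> \<psi> x = 0"
  shows "(LINT x|lborel. U x \<bullet> P x) = (LINT x|lborel. f (u x) * \<psi> x)"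
proof -
  note suppP = C1_grad_support[OF \<psi> supp]
  note [continuous_intros] = continuous_on_compose2[OF C1_grad_cont[OF \<psi>] _ subset_UNIV]
    continuous_on_compose2[OF C1_grad_cont'[OF \<psi>] _ subset_UNIV]
  note int = integrable_lborel_compact_support[where R=R]
  define k where "k i x = U x $ i * P x $ i + \<psi> x * A i x $ i" for i x
  have k: "integrable lborel (k i)" "(LINT x|lborel. k i x) = 0" for i
  proof -
    show "integrable lborel (k i)" unfolding k_def
      by (rule int, intro continuous_intros) (simp add: supp suppP)
    show "(LINT x|lborel. k i x) = 0"
      using integral_gradient_eq_0[OF C1_grad_mult[OF U_C1[of i] \<psi>], of R "axis i 1"] supp
      by (simp add: k_def inner_axis inner_add_left)
  qed
  have "(LINT x|lborel. U x \<bullet> P x - f (u x) * \<psi> x) = (LINT x|lborel. (\<Sum>i\<in>UNIV. k i x))"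
  proof (rule arg_cong[where f="integral\<^sup>L lborel"], rule ext)
    fix x
    show "U x \<bullet> P x - f (u x) * \<psi> x = (\<Sum>i\<in>UNIV. k i x)"
      using pde[of x] by (simp add: k_def sum.distrib inner_vec_def flip: sum_distrib_left)
  qed
  also have "\<dots> = 0" using k by simp
  finally have "(LINT x|lborel. U x \<bullet> P x - f (u x) * \<psi> x) = 0" .
  moreover have "integrable lborel (\<lambda>x. U x \<bullet> P x)"
    by (rule int, intro continuous_intros) (simp add: supp suppP)
  moreover have "integrable lborel (\<lambda>x. f (u x) * \<psi> x)"
    by (rule int, intro continuous_intros) (simp add: supp suppP)
  ultimately show ?thesis by simp
qed

text \<open>The solution is only \<open>C\<^sup>2\<close>, so the equation cannot be differentiated pointwise. Instead the weak
  equation is differentiated along translations of the test function.\<close>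
lemma linearized_equation:
  assumes \<psi>: "C1_grad \<psi> P" and supp: "\<And>x. norm x > R \<Longrightarrow> \<psi> x = 0"
  shows "(LINT x|lborel. A i x \<bullet> P x) = (LINT x|lborel. f' (u x) * U x $ i * \<psi> x)"
proof -
  note suppP = C1_grad_support[OF \<psi> supp]
  note [continuous_intros] = continuous_on_compose2[OF C1_grad_cont[OF \<psi>] _ subset_UNIV]
    continuous_on_compose2[OF C1_grad_cont'[OF \<psi>] _ subset_UNIV]
  note int = integrable_lborel_compact_support[where R=R]
  define e :: "real^'n" where "e = axis i 1"
  define k where "k t x = U (x + t *\<^sub>R e) \<bullet> P x - f (u (x + t *\<^sub>R e)) * \<psi> x" for t x
  define k' where "k' t x = (\<Sum>j\<in>UNIV. A j (x + t *\<^sub>R e) \<bullet> e * P x $ j)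
    - f' (u (x + t *\<^sub>R e)) * (U (x + t *\<^sub>R e) \<bullet> e) * \<psi> x" for t x
  have "(LINT x|lborel. k' 0 x) = 0"
  proof (rule integral_derivative_eq_0)
    show "((\<lambda>t. k t x) has_real_derivative k' t x) (at t)" for t x
      unfolding k_def k'_def inner_vec_def inner_real_def
      by (intro DERIV_diff DERIV_sum DERIV_cmult_right C1_grad_line[OF U_C1, unfolded inner_vec_def inner_real_def]
          DERIV_chain2[OF f_deriv] C1_grad_line[OF u_C1, unfolded inner_vec_def inner_real_def])
    show "continuous_on UNIV (k t)" for t
      unfolding k_def by (intro continuous_intros)
    show "continuous_on UNIV (\<lambda>(t, x). k' t x)"
      unfolding k'_def case_prod_beta by (intro continuous_intros)
    show "k t x = 0" if "norm x > R" for t x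
      using that by (simp add: k_def supp suppP)
    \<comment> \<open>A change of variables moves the shift from the solution to the test function,
      and the weak equation holds for the shifted test function.\<close>
    show "(LINT x|lborel. k t x) = 0" for t
    proof -
      define R' where "R' = R + norm (t *\<^sub>R e)"
      have supp': "\<psi> (x - t *\<^sub>R e) = 0" if "norm x > R'" for x
        using that norm_triangle_ineq2[of x "t *\<^sub>R e"] by (intro supp) (simp add: R'_def)
      have \<psi>': "C1_grad (\<lambda>x. \<psi> (x - t *\<^sub>R e)) (\<lambda>x. P (x - t *\<^sub>R e))"
        using C1_grad_translate[OF \<psi>, of "- (t *\<^sub>R e)"] by simp
      note suppP' = C1_grad_support[OF \<psi>' supp']
      define g where "g x = U x \<bullet> P (x - t *\<^sub>R e) - f (u x) * \<psi> (x - t *\<^sub>R e)" for x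
      have "(LINT x|lborel. k t x) = (LINT x|lborel. g (x + t *\<^sub>R e))"
        by (simp add: g_def k_def)
      also have "\<dots> = (LINT x|lborel. g x)"
        unfolding g_def
        by (intro lborel_integral_translate borel_measurable_continuous_onI continuous_intros)
      also have "\<dots> = (LINT x|lborel. U x \<bullet> P (x - t *\<^sub>R e)) - (LINT x|lborel. f (u x) * \<psi> (x - t *\<^sub>R e))"
        unfolding g_def
        by (intro Bochner_Integration.integral_diff integrable_lborel_compact_support[where R=R']
            continuous_intros) (simp_all add: supp' suppP')
      also have "\<dots> = 0" using weak_equation[OF \<psi>' supp'] by simp
      finally show ?thesis .
    qed
  qed
  \<comment> \<open>The derivative along \<open>e\<close> produces the \<open>i\<close>-th column of
    the Hessian; symmetry turns it into the row \<open>A i\<close>.\<close>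
  moreover have "k' 0 x = A i x \<bullet> P x - f' (u x) * U x $ i * \<psi> x" for x
  proof -
    have "v \<bullet> e = v $ i" for v by (simp add: e_def inner_axis)
    then have "k' 0 x = (\<Sum>j\<in>UNIV. A j x $ i * P x $ j) - f' (u x) * U x $ i * \<psi> x"
      by (simp add: k'_def)
    then show ?thesis by (simp add: hessian_symmetric[of _ x i] inner_vec_def)
  qed
  moreover have "integrable lborel (\<lambda>x. A i x \<bullet> P x)"
    by (rule int, intro continuous_intros) (simp add: supp suppP)
  moreover have "integrable lborel (\<lambda>x. f' (u x) * U x $ i * \<psi> x)"
    by (rule int, intro continuous_intros) (simp add: supp suppP)
  ultimately show ?thesis by simp
qed

text \<open>A Caccioppoli estimate: the weak equation is tested with
  \<open>(u - B) \<eta>\<^sup>2\<close>. As \<open>u - B\<close> is nonpositive and \<open>f\<close>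
  nonnegative, the right-hand side has a sign and drops out, whatever the size of \<open>f\<close>.
  The constant comes from \<open>|u - B| \<le> 2 * B\<close>.\<close>

lemma energy_estimate:
  assumes f: "\<And>t. f t \<ge> 0" and B: "\<And>x. \<bar>u x\<bar> \<le> B"
    and \<eta>: "C1_grad \<eta> E" and supp: "\<And>x. norm x > R \<Longrightarrow> \<eta> x = 0"
  shows "(LINT x|lborel. (\<eta> x)\<^sup>2 * (norm (U x))\<^sup>2) \<le> 16 * B\<^sup>2 * (LINT x|lborel. (norm (E x))\<^sup>2)"
proof -
  note suppE = C1_grad_support[OF \<eta> supp]
  note [continuous_intros] = continuous_on_compose2[OF C1_grad_cont[OF \<eta>] _ subset_UNIV]
    continuous_on_compose2[OF C1_grad_cont'[OF \<eta>] _ subset_UNIV]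
  note int = integrable_lborel_compact_support[where R=R]
  define w where "w x = u x + - B" for x
  have w: "C1_grad w U"
    unfolding w_def using C1_grad_add[OF u_C1 C1_grad_const[of "-B"]] by simp
  have wB: "w x \<le> 0" "\<bar>w x\<bar> \<le> 2 * B" for x using B[of x] by (auto simp: w_def)
  note [continuous_intros] = continuous_on_compose2[OF C1_grad_cont[OF w] _ subset_UNIV]
  note \<psi> = C1_grad_mult[OF w C1_grad_mult[OF \<eta> \<eta>]]
  define K where "K x = U x \<bullet> (w x *\<^sub>R (\<eta> x *\<^sub>R E x + \<eta> x *\<^sub>R E x) + (\<eta> x * \<eta> x) *\<^sub>R U x)" for x
  have intK: "integrable lborel K"
    unfolding K_def by (rule int, intro continuous_intros) (simp add: supp suppE)
  have intE: "integrable lborel (\<lambda>x. (norm (E x))\<^sup>2)"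
    by (rule int, intro continuous_intros) (simp add: supp suppE)
  have "(LINT x|lborel. K x) = (LINT x|lborel. f (u x) * (w x * (\<eta> x * \<eta> x)))"
    unfolding K_def by (rule weak_equation[OF \<psi>, of R]) (simp add: supp)
  also have "\<dots> \<le> 0"
  proof -
    have "0 \<le> (LINT x|lborel. - (f (u x) * (w x * (\<eta> x * \<eta> x))))"
      using f wB(1) by (intro Bochner_Integration.integral_nonneg) (simp add: mult_nonneg_nonpos mult_nonpos_nonneg)
    then show ?thesis by simp
  qed
  finally have K0: "(LINT x|lborel. K x) \<le> 0" .
  have "(LINT x|lborel. (\<eta> x)\<^sup>2 * (norm (U x))\<^sup>2)
      \<le> (LINT x|lborel. 2 * K x + 16 * B\<^sup>2 * (norm (E x))\<^sup>2)"
  proof (rule integral_mono)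
    show "integrable lborel (\<lambda>x. (\<eta> x)\<^sup>2 * (norm (U x))\<^sup>2)"
      by (rule int, intro continuous_intros) (simp add: supp suppE)
    show "integrable lborel (\<lambda>x. 2 * K x + 16 * B\<^sup>2 * (norm (E x))\<^sup>2)"
      using intK intE by simp
    fix x
    have "(w x)\<^sup>2 \<le> (2 * B)\<^sup>2" using wB(2)[of x] by (rule abs_le_square_iff[THEN iffD1, OF order_trans]) simp
    then have "4 * (w x)\<^sup>2 * (norm (E x))\<^sup>2 \<le> 16 * B\<^sup>2 * (norm (E x))\<^sup>2"
      by (intro mult_right_mono) auto
    \<comment> \<open>Young's inequality for the cross term: this square equals
      \<open>2 * K x + 4 * (w x)\<^sup>2 * (norm (E x))\<^sup>2\<close> minus the integrand on the
      left.\<close>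
    moreover have "0 \<le> (norm (\<eta> x *\<^sub>R U x + (2 * w x) *\<^sub>R E x))\<^sup>2" by simp
    then have "0 \<le> (\<eta> x)\<^sup>2 * (norm (U x))\<^sup>2 + 4 * w x * \<eta> x * (U x \<bullet> E x) + 4 * (w x)\<^sup>2 * (norm (E x))\<^sup>2"
      unfolding power2_norm_eq_inner
      by (simp add: inner_add_left inner_add_right inner_commute[of "E x" "U x"] power2_eq_square algebra_simps)
    moreover have "K x = (\<eta> x)\<^sup>2 * (norm (U x))\<^sup>2 + 2 * w x * \<eta> x * (U x \<bullet> E x)"
      unfolding power2_norm_eq_inner
      by (simp only: K_def inner_add_right inner_scaleR_right) (simp add: power2_eq_square algebra_simps)
    ultimately show "(\<eta> x)\<^sup>2 * (norm (U x))\<^sup>2 \<le> 2 * K x + 16 * B\<^sup>2 * (norm (E x))\<^sup>2"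
      by (simp add: algebra_simps)
  qed
  also have "\<dots> = 2 * (LINT x|lborel. K x) + 16 * B\<^sup>2 * (LINT x|lborel. (norm (E x))\<^sup>2)"
    using intK intE by simp
  finally show ?thesis using K0 by simp
qed

end

section \<open>The stability inequality tested with the length of the gradient\<close>

locale stable_semilinear = semilinear f f' u U A
  for f f' :: "real \<Rightarrow> real" and u :: "real^'n \<Rightarrow> real"
    and U :: "real^'n \<Rightarrow> real^'n" and A :: "'n \<Rightarrow> real^'n \<Rightarrow> real^'n" +
  assumes stable: "\<And>\<xi> \<Xi> R. C1_grad \<xi> \<Xi> \<Longrightarrow> (\<And>x. norm x > R \<Longrightarrow> \<xi> x = 0) \<Longrightarrow>
    (LINT x|lborel. f' (u x) * (\<xi> x)\<^sup>2) \<le> (LINT x|lborel. (norm (\<Xi> x))\<^sup>2)"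
begin

text \<open>The Hessian applied to the gradient, which is half the gradient of
  \<open>|U|\<^sup>2\<close>. Where \<open>U\<close> is nonzero, its length divided by
  \<open>norm (U x)\<close> is the length of the gradient of \<open>|U|\<close>.\<close>

definition hess_grad :: "real^'n \<Rightarrow> real^'n"
  where "hess_grad x = (\<Sum>i\<in>UNIV. U x $ i *\<^sub>R A i x)"

lemma hess_grad_cont [continuous_intros]: "continuous_on X g \<Longrightarrow> continuous_on X (\<lambda>x. hess_grad (g x))"
  unfolding hess_grad_def by (intro continuous_intros)

text \<open>The Sternberg-Zumbrun inequality with a regularization: \<open>\<epsilon>\<close> makes
  the square root C^1 at zeros of \<open>U\<close>, at the cost of the last term. Stability is
  tested with \<open>sqrt (q x) * \<eta> x\<close> and the linearized equations with
  \<open>U x $ i * (\<eta> x)\<^sup>2\<close>.\<close>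

lemma stability_gradient:
  assumes \<eta>: "C1_grad \<eta> E" and supp: "\<And>x. norm x > R \<Longrightarrow> \<eta> x = 0" and \<epsilon>: "\<epsilon> > 0"
  shows "(LINT x|lborel. ((\<Sum>i\<in>UNIV. (norm (A i x))\<^sup>2) - (norm (hess_grad x))\<^sup>2 / ((norm (U x))\<^sup>2 + \<epsilon>)) * (\<eta> x)\<^sup>2)
    \<le> (LINT x|lborel. (norm (U x))\<^sup>2 * (norm (E x))\<^sup>2)
      + \<epsilon> * ((LINT x|lborel. (norm (E x))\<^sup>2) - (LINT x|lborel. f' (u x) * (\<eta> x)\<^sup>2))"
proof -
  note suppE = C1_grad_support[OF \<eta> supp]
  note [continuous_intros] = continuous_on_compose2[OF C1_grad_cont[OF \<eta>] _ subset_UNIV]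
    continuous_on_compose2[OF C1_grad_cont'[OF \<eta>] _ subset_UNIV]
  note int = integrable_lborel_compact_support[where R=R]
  define q where "q x = (\<Sum>i\<in>UNIV. U x $ i * U x $ i) + \<epsilon>" for x
  have q_eq: "q x = (norm (U x))\<^sup>2 + \<epsilon>" for x
    by (simp add: q_def power2_norm_eq_inner inner_vec_def)
  have q_pos: "q x > 0" for x using \<epsilon> by (simp add: q_eq add_nonneg_pos)
  have q: "C1_grad q (\<lambda>x. 2 *\<^sub>R hess_grad x)"
  proof -
    have "C1_grad (\<lambda>x. \<Sum>i\<in>UNIV. U x $ i * U x $ i)
        (\<lambda>x. \<Sum>i\<in>UNIV. U x $ i *\<^sub>R A i x + U x $ i *\<^sub>R A i x)"
      by (intro C1_grad_sum C1_grad_mult U_C1)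
    from C1_grad_add[OF this C1_grad_const[of \<epsilon>]] show ?thesis
      by (simp only: q_def[abs_def] hess_grad_def[abs_def] scaleR_2 sum.distrib add_0_right)
  qed
  note [continuous_intros] = continuous_on_compose2[OF C1_grad_cont[OF q] _ subset_UNIV]
  have q_nz: "q x \<noteq> 0" "sqrt (q x) \<noteq> 0" for x using q_pos[of x] by auto
  have s: "C1_grad (\<lambda>x. sqrt (q x)) (\<lambda>x. (inverse (sqrt (q x)) / 2) *\<^sub>R (2 *\<^sub>R hess_grad x))"
    by (rule C1_grad_compose[OF q, of sqrt "\<lambda>y. inverse (sqrt y) / 2"])
      (use q_pos q_nz in \<open>auto intro!: DERIV_real_sqrt continuous_intros\<close>)
  define \<Xi> where "\<Xi> x = sqrt (q x) *\<^sub>R E x + \<eta> x *\<^sub>R (inverse (sqrt (q x)) / 2) *\<^sub>R (2 *\<^sub>R hess_grad x)" for x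
  have \<xi>: "C1_grad (\<lambda>x. sqrt (q x) * \<eta> x) \<Xi>"
    unfolding \<Xi>_def[abs_def] by (rule C1_grad_mult[OF s \<eta>])
  have \<Xi>_eq: "(norm (\<Xi> x))\<^sup>2 = q x * (norm (E x))\<^sup>2 + 2 * \<eta> x * (hess_grad x \<bullet> E x) + (\<eta> x)\<^sup>2 * (norm (hess_grad x))\<^sup>2 / q x" for x
  proof -
    define r where "r = sqrt (q x)"
    have r: "r \<noteq> 0" "q x = r * r" using q_pos[of x] by (auto simp: r_def)
    have "\<Xi> x = r *\<^sub>R E x + (\<eta> x / r) *\<^sub>R hess_grad x" by (simp add: \<Xi>_def r_def field_simps)
    then show ?thesis
      unfolding power2_norm_eq_inner using r
      by (simp add: inner_add_left inner_add_right inner_commute[of "E x" "hess_grad x"] field_simps power2_eq_square)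
  qed
  have st: "(LINT x|lborel. f' (u x) * (sqrt (q x) * \<eta> x)\<^sup>2) \<le> (LINT x|lborel. (norm (\<Xi> x))\<^sup>2)"
    by (rule stable[OF \<xi>, of R]) (simp add: supp)
  note \<psi> = C1_grad_mult[OF U_C1 C1_grad_mult[OF \<eta> \<eta>]]
  \<comment> \<open>The sum over \<open>i\<close> of the left-hand integrands of the linearized
    equations.\<close>
  define K where "K x = 2 * \<eta> x * (hess_grad x \<bullet> E x) + (\<eta> x)\<^sup>2 * (\<Sum>i\<in>UNIV. (norm (A i x))\<^sup>2)" for x
  define J where "J i x = A i x \<bullet> (U x $ i *\<^sub>R (\<eta> x *\<^sub>R E x + \<eta> x *\<^sub>R E x) + (\<eta> x * \<eta> x) *\<^sub>R A i x)" for i x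
  have "J i x = 2 * \<eta> x * ((U x $ i *\<^sub>R A i x) \<bullet> E x) + (\<eta> x)\<^sup>2 * (norm (A i x))\<^sup>2" for i x
    unfolding J_def power2_norm_eq_inner inner_add_right inner_scaleR_right inner_scaleR_left
    by (simp add: power2_eq_square algebra_simps)
  then have K_J: "K x = (\<Sum>i\<in>UNIV. J i x)" for x
    by (simp add: K_def hess_grad_def inner_sum_left sum.distrib sum_distrib_left)
  have intJ: "integrable lborel (J i)" for i
    unfolding J_def by (rule int, intro continuous_intros) (simp add: supp suppE)
  have J_eq: "(LINT x|lborel. J i x) = (LINT x|lborel. f' (u x) * U x $ i * (U x $ i * (\<eta> x * \<eta> x)))" for i
    unfolding J_def by (rule linearized_equation[OF \<psi>, of R]) (simp add: supp)
  have "(LINT x|lborel. K x) = (\<Sum>i\<in>UNIV. LINT x|lborel. J i x)"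
    unfolding K_J by (rule Bochner_Integration.integral_sum) (rule intJ)
  also have "\<dots> = (\<Sum>i\<in>UNIV. LINT x|lborel. f' (u x) * U x $ i * (U x $ i * (\<eta> x * \<eta> x)))"
    by (simp add: J_eq)
  also have "\<dots> = (LINT x|lborel. (\<Sum>i\<in>UNIV. f' (u x) * U x $ i * (U x $ i * (\<eta> x * \<eta> x))))"
    by (rule Bochner_Integration.integral_sum[symmetric], rule int, intro continuous_intros) (simp add: supp)
  also have "\<dots> = (LINT x|lborel. f' (u x) * (norm (U x))\<^sup>2 * (\<eta> x)\<^sup>2)"
    by (simp add: power2_norm_eq_inner inner_vec_def sum_distrib_left sum_distrib_right power2_eq_square[of "\<eta> _"] mult_ac)
  finally have K_eq: "(LINT x|lborel. K x) = (LINT x|lborel. f' (u x) * (norm (U x))\<^sup>2 * (\<eta> x)\<^sup>2)" .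
  have i1: "integrable lborel K"
    unfolding K_def by (rule int, intro continuous_intros) (simp add: supp suppE)
  have cont_\<Xi>: "continuous_on UNIV \<Xi>" by (rule C1_grad_cont'[OF \<xi>])
  have \<Xi>0: "\<Xi> x = 0" if "norm x > R" for x
    by (rule C1_grad_support[OF \<xi> _ that]) (simp add: supp)
  have i2: "integrable lborel (\<lambda>x. (norm (\<Xi> x))\<^sup>2)"
    by (rule int, intro continuous_intros cont_\<Xi>) (simp add: \<Xi>0)
  have i3: "integrable lborel (\<lambda>x. (norm (U x))\<^sup>2 * (norm (E x))\<^sup>2)"
    by (rule int, intro continuous_intros) (simp add: suppE)
  have i4: "integrable lborel (\<lambda>x. (norm (E x))\<^sup>2)"
    by (rule int, intro continuous_intros) (simp add: suppE)
  have i5: "integrable lborel (\<lambda>x. f' (u x) * (norm (U x))\<^sup>2 * (\<eta> x)\<^sup>2)"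
    by (rule int, intro continuous_intros) (simp add: supp)
  have i6: "integrable lborel (\<lambda>x. f' (u x) * (\<eta> x)\<^sup>2)"
    by (rule int, intro continuous_intros) (simp add: supp)
  \<comment> \<open>The cross terms \<open>2 * \<eta> x * (hess_grad x \<bullet> E x)\<close> of
    \<open>K\<close> and of \<open>|\<Xi>|\<^sup>2\<close> cancel. Below, the integrals of
    \<open>f' (u x) * (norm (U x))\<^sup>2 * (\<eta> x)\<^sup>2\<close> cancel as well.\<close>
  have "(LINT x|lborel. ((\<Sum>i\<in>UNIV. (norm (A i x))\<^sup>2) - (norm (hess_grad x))\<^sup>2 / ((norm (U x))\<^sup>2 + \<epsilon>)) * (\<eta> x)\<^sup>2)
    = (LINT x|lborel. K x - (norm (\<Xi> x))\<^sup>2 + ((norm (U x))\<^sup>2 * (norm (E x))\<^sup>2 + \<epsilon> * (norm (E x))\<^sup>2))"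
    by (rule Bochner_Integration.integral_cong) (simp_all add: K_def \<Xi>_eq q_eq algebra_simps)
  also have "\<dots> = (LINT x|lborel. K x) - (LINT x|lborel. (norm (\<Xi> x))\<^sup>2)
      + ((LINT x|lborel. (norm (U x))\<^sup>2 * (norm (E x))\<^sup>2) + \<epsilon> * (LINT x|lborel. (norm (E x))\<^sup>2))"
    using i1 i2 i3 i4 by simp
  also have "\<dots> \<le> (LINT x|lborel. K x) - (LINT x|lborel. f' (u x) * (sqrt (q x) * \<eta> x)\<^sup>2)
      + ((LINT x|lborel. (norm (U x))\<^sup>2 * (norm (E x))\<^sup>2) + \<epsilon> * (LINT x|lborel. (norm (E x))\<^sup>2))"
    using st by simp
  also have "(LINT x|lborel. f' (u x) * (sqrt (q x) * \<eta> x)\<^sup>2)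
      = (LINT x|lborel. f' (u x) * (norm (U x))\<^sup>2 * (\<eta> x)\<^sup>2 + \<epsilon> * (f' (u x) * (\<eta> x)\<^sup>2))"
  proof (rule Bochner_Integration.integral_cong[OF refl])
    fix x
    have "(sqrt (q x) * \<eta> x)\<^sup>2 = q x * (\<eta> x)\<^sup>2"
      using q_pos[of x] by (simp add: power_mult_distrib)
    then show "f' (u x) * (sqrt (q x) * \<eta> x)\<^sup>2 = f' (u x) * (norm (U x))\<^sup>2 * (\<eta> x)\<^sup>2 + \<epsilon> * (f' (u x) * (\<eta> x)\<^sup>2)"
      by (simp add: q_eq algebra_simps)
  qed
  also have "\<dots> = (LINT x|lborel. K x) + \<epsilon> * (LINT x|lborel. f' (u x) * (\<eta> x)\<^sup>2)"
    using i5 i6 by (simp add: K_eq)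
  finally show ?thesis by (simp add: algebra_simps)
qed

end

section \<open>A C^1 cutoff, its scalings, and an identity for weighted sums\<close>

lemma pos_part_square_deriv:
  "((\<lambda>t::real. (max 0 t)\<^sup>2) has_real_derivative 2 * max 0 t) (at t)"
proof -
  consider "t < 0" | "t = 0" | "t > 0" by linarith
  then show ?thesis
  proof cases
    case 1
    have "((\<lambda>t::real. 0) has_real_derivative 2 * max 0 t) (at t)" using 1 by (auto simp: max_def)
    then show ?thesis
      by (rule has_field_derivative_transform_within_open[where S="{..<0}"]) (use 1 in auto)
  next
    case 3
    have "((\<lambda>t::real. t\<^sup>2) has_real_derivative 2 * max 0 t) (at t)"
      using 3 by (auto intro!: derivative_eq_intros simp: max_def)
    then show ?thesis
      by (rule has_field_derivative_transform_within_open[where S="{0<..}"]) (use 3 in auto)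
  next
    case 2
    have "(\<lambda>h::real. (max 0 h)\<^sup>2 / h) \<midarrow>0\<rightarrow> 0"
    proof (rule Lim_null_comparison)
      show "\<forall>\<^sub>F h in at 0. norm ((max 0 h)\<^sup>2 / h) \<le> \<bar>h\<bar>" for h :: real
        by (rule always_eventually) (auto simp: max_def power2_eq_square)
      show "((\<lambda>h::real. \<bar>h\<bar>) \<longlongrightarrow> 0) (at 0)"
        by (rule tendsto_rabs_zero) (rule tendsto_ident_at)
    qed
    then show ?thesis using 2 by (simp add: DERIV_def)
  qed
qed

lemma C1_grad_norm_square:
  "C1_grad (\<lambda>x::'a::euclidean_space. (norm x)\<^sup>2) (\<lambda>x. 2 *\<^sub>R x)"
  unfolding C1_grad_def power2_norm_eq_inner
  by (auto intro!: derivative_eq_intros continuous_intros simp: inner_commute)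

text \<open>The profile is \<open>max(0, 1 - max(0, s - 1)\<^sup>2)\<^sup>2\<close> with \<open>s = |x|\<^sup>2\<close>; the square of a positive part is \<open>C\<^sup>1\<close>.\<close>
lemma C1_cutoff_exists:
  obtains \<theta> :: "'a::euclidean_space \<Rightarrow> real" and X C where
    "C1_grad \<theta> X" "\<And>x. norm x \<le> 1 \<Longrightarrow> \<theta> x = 1" "\<And>x. norm x \<ge> 2 \<Longrightarrow> \<theta> x = 0"
    "\<And>x. norm x \<le> 1 \<or> norm x \<ge> 2 \<Longrightarrow> X x = 0" "\<And>x. norm (X x) \<le> C"
proof -
  define a where "a x = (norm x)\<^sup>2 + -1" for x :: 'a
  have a: "C1_grad a (\<lambda>x. 2 *\<^sub>R x)"
    unfolding a_def using C1_grad_add[OF C1_grad_norm_square C1_grad_const[of "-1"]] by simp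
  define b where "b x = 1 + (-1) * (max 0 (a x))\<^sup>2" for x
  define B where "B x = - ((2 * max 0 (a x)) *\<^sub>R (2 *\<^sub>R x))" for x
  have b: "C1_grad b B"
    using C1_grad_add[OF C1_grad_const[of 1] C1_grad_mult[OF C1_grad_const[of "-1"] C1_grad_compose[OF a pos_part_square_deriv]]]
    by (simp add: b_def[abs_def] B_def[abs_def] continuous_intros C1_grad_cont[OF a])
  define \<theta> where "\<theta> x = (max 0 (b x))\<^sup>2" for x
  define X where "X x = (2 * max 0 (b x)) *\<^sub>R B x" for x
  have \<theta>: "C1_grad \<theta> X"
    using C1_grad_compose[OF b pos_part_square_deriv]
    by (simp add: \<theta>_def[abs_def] X_def[abs_def] continuous_intros C1_grad_cont[OF b])
  have a1: "max 0 (a x) = 0" if "norm x \<le> 1" for x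
    using that abs_square_le_1[of "norm x"] by (simp add: a_def)
  have b2: "max 0 (b x) = 0" if "norm x \<ge> 2" for x
  proof -
    have "2\<^sup>2 \<le> (norm x)\<^sup>2" using that by (intro power_mono) auto
    then have "a x \<ge> 1" by (simp add: a_def)
    then have "1 \<le> (max 0 (a x))\<^sup>2" by (simp add: one_le_power)
    then show ?thesis by (simp add: b_def)
  qed
  have X0: "X x = 0" if "norm x \<le> 1 \<or> norm x \<ge> 2" for x
    using that a1 b2 by (auto simp: X_def B_def)
  have "bounded (X ` cball 0 2)"
    by (intro compact_imp_bounded compact_continuous_image continuous_on_subset[OF C1_grad_cont'[OF \<theta>]]) auto
  then obtain C where "\<forall>y\<in>X ` cball 0 2. norm y \<le> C"
    unfolding bounded_iff by blast
  then have C: "norm (X x) \<le> C" if "norm x \<le> 2" for x using that by simp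
  have "norm (X x) \<le> C" for x
    using C[of x] X0[of x] order_trans[OF norm_ge_zero C[of 0]] by (cases "norm x \<le> 2") simp_all
  then show ?thesis
    using that[OF \<theta>] X0 a1 b2 by (auto simp: \<theta>_def b_def)
qed

lemma C1_grad_scale:
  assumes "C1_grad g G"
  shows "C1_grad (\<lambda>x. g (c *\<^sub>R x)) (\<lambda>x. c *\<^sub>R G (c *\<^sub>R x))"
  unfolding C1_grad_def
proof (intro conjI allI)
  show "continuous_on UNIV (\<lambda>x. c *\<^sub>R G (c *\<^sub>R x))"
    by (intro continuous_on_compose2[OF C1_grad_cont'[OF assms] _ subset_UNIV] continuous_intros)
  show "((\<lambda>x. g (c *\<^sub>R x)) has_derivative (\<lambda>h. (c *\<^sub>R G (c *\<^sub>R x)) \<bullet> h)) (at x)" for x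
    by (rule has_derivative_eq_rhs[OF has_derivative_compose[OF _ C1_grad_deriv[OF assms]]])
      (auto intro!: derivative_eq_intros)
qed

text \<open>The defect in the Cauchy-Schwarz inequality
  \<open>|S|\<^sup>2 \<le> W * (\<Sum>i\<in>I. |a i|\<^sup>2)\<close>, divided by \<open>W\<close>,
  written as a sum of squares: \<open>S /\<^sub>R W\<close> is the least-squares vector for fitting
  each \<open>a i\<close> by \<open>v i\<close> times a common vector.\<close>

lemma weighted_sum_norm_square:
  fixes a :: "'i \<Rightarrow> 'v::real_inner" and v :: "'i \<Rightarrow> real"
  assumes "finite I"
  defines "S \<equiv> \<Sum>i\<in>I. v i *\<^sub>R a i" and "W \<equiv> \<Sum>i\<in>I. (v i)\<^sup>2"
  assumes "W \<noteq> 0"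
  shows "(\<Sum>i\<in>I. (norm (a i - v i *\<^sub>R (S /\<^sub>R W)))\<^sup>2) = (\<Sum>i\<in>I. (norm (a i))\<^sup>2) - (norm S)\<^sup>2 / W"
proof -
  have "(norm (a i - v i *\<^sub>R (S /\<^sub>R W)))\<^sup>2 = (norm (a i))\<^sup>2 - 2 / W * ((v i *\<^sub>R a i) \<bullet> S) + (v i)\<^sup>2 * ((norm S)\<^sup>2 / W\<^sup>2)" for i
    unfolding power2_norm_eq_inner using assms(4)
    by (simp add: inner_diff_left inner_diff_right inner_commute[of S "a i"] power2_eq_square field_simps)
  then have "(\<Sum>i\<in>I. (norm (a i - v i *\<^sub>R (S /\<^sub>R W)))\<^sup>2)
    = (\<Sum>i\<in>I. (norm (a i))\<^sup>2) - 2 / W * (\<Sum>i\<in>I. (v i *\<^sub>R a i) \<bullet> S) + W * ((norm S)\<^sup>2 / W\<^sup>2)"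
    by (simp only: sum.distrib sum_subtractf sum_distrib_left[symmetric] sum_distrib_right[symmetric] W_def)
  also have "(\<Sum>i\<in>I. (v i *\<^sub>R a i) \<bullet> S) = (norm S)\<^sup>2"
    by (simp only: inner_sum_left[symmetric] S_def[symmetric] power2_norm_eq_inner)
  finally show ?thesis using assms(4) by (simp add: power2_eq_square field_simps)
qed

section \<open>Dyadic cutoffs and the rank of the Hessian\<close>

context stable_semilinear
begin

text \<open>One cutoff at scale \<open>2 ^ k\<close> has weighted energy bounded independently of
  \<open>k\<close>, which is not yet small. Averaging \<open>L\<close> of them gains a factor
  \<open>1 / L\<close>: their gradients live on disjoint annuli, so \<open>L\<close> bounded terms
  appear with weight \<open>1 / L\<^sup>2\<close>. The constant depends on neither \<open>r\<close>
  nor \<open>L\<close>.\<close>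

lemma cutoff_energy:
  assumes f: "\<And>t. f t \<ge> 0" and B: "\<And>x. \<bar>u x\<bar> \<le> B" and N: "CARD('n) \<le> 4"
  obtains C where "\<And>r L. L > 0 \<Longrightarrow> \<exists>\<eta> E R. C1_grad \<eta> E \<and> (\<forall>x. norm x > R \<longrightarrow> \<eta> x = 0)
    \<and> (\<forall>x. norm x \<le> 2 ^ r \<longrightarrow> \<eta> x = 1)
    \<and> (LINT x|lborel. (norm (U x))\<^sup>2 * (norm (E x))\<^sup>2) \<le> C / real L"
proof -
  obtain \<theta> :: "real^'n \<Rightarrow> real" and X K where \<theta>: "C1_grad \<theta> X"
    and \<theta>1: "\<And>x. norm x \<le> 1 \<Longrightarrow> \<theta> x = 1" and \<theta>2: "\<And>x. norm x \<ge> 2 \<Longrightarrow> \<theta> x = 0"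
    and X0: "\<And>x. norm x \<le> 1 \<or> norm x \<ge> 2 \<Longrightarrow> X x = 0" and K: "\<And>x. norm (X x) \<le> K"
    by (rule C1_cutoff_exists) blast
  define \<theta>k where "\<theta>k k x = \<theta> ((1 / 2 ^ k) *\<^sub>R x)" for k :: nat and x
  define Xk where "Xk k x = (1 / 2 ^ k) *\<^sub>R X ((1 / 2 ^ k) *\<^sub>R x)" for k :: nat and x
  have \<theta>k: "C1_grad (\<theta>k k) (Xk k)" for k
    unfolding \<theta>k_def[abs_def] Xk_def[abs_def] by (rule C1_grad_scale[OF \<theta>])
  have \<theta>k1: "\<theta>k k x = 1" if "norm x \<le> 2 ^ k" for k x
    unfolding \<theta>k_def by (rule \<theta>1) (use that in \<open>simp add: field_simps\<close>)
  have \<theta>k0: "\<theta>k k x = 0" if "norm x \<ge> 2 ^ Suc k" for k x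
    unfolding \<theta>k_def by (rule \<theta>2) (use that in \<open>simp add: field_simps\<close>)
  have Xk0: "Xk k x = 0" if "norm x \<le> 2 ^ k \<or> norm x \<ge> 2 ^ Suc k" for k x
    unfolding Xk_def using X0[of "(1 / 2 ^ k) *\<^sub>R x"] that by (simp add: field_simps)
  have Xk: "(norm (Xk k x))\<^sup>2 \<le> K\<^sup>2 / 4 ^ k" for k x
  proof -
    have "norm (Xk k x) \<le> K / 2 ^ k" using K by (simp add: Xk_def field_simps)
    then have "(norm (Xk k x))\<^sup>2 \<le> (K / 2 ^ k)\<^sup>2" by (intro power_mono) auto
    also have "\<dots> = K\<^sup>2 / 4 ^ k"
      by (simp add: power_divide power2_eq_square flip: power_mult_distrib)
    finally show ?thesis .
  qed
  note [continuous_intros] = continuous_on_compose2[OF C1_grad_cont[OF \<theta>k] _ subset_UNIV]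
    continuous_on_compose2[OF C1_grad_cont'[OF \<theta>k] _ subset_UNIV]
  have intX: "integrable lborel (\<lambda>x. (norm (Xk k x))\<^sup>2)" for k
    by (rule integrable_lborel_compact_support[where R="2 ^ Suc k"], intro continuous_intros)
      (simp add: Xk0)
  have intUX: "integrable lborel (\<lambda>x. (norm (U x))\<^sup>2 * (norm (Xk k x))\<^sup>2)" for k
    by (rule integrable_lborel_compact_support[where R="2 ^ Suc k"], intro continuous_intros)
      (simp add: Xk0)
  define \<omega> where "\<omega> = unit_ball_vol (real CARD('n))"
  have \<omega>: "\<omega> \<ge> 0" by (simp add: \<omega>_def)
  have dirichlet: "(LINT x|lborel. (norm (Xk k x))\<^sup>2) \<le> 16 * K\<^sup>2 * \<omega> * 4 ^ k" for k
  proof -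
    let ?b = "cball (0::real^'n) (2 ^ Suc k)"
    have "(LINT x|lborel. (norm (Xk k x))\<^sup>2) \<le> (LINT x|lborel. K\<^sup>2 / 4 ^ k * indicator ?b x)"
    proof (rule integral_mono[OF intX])
      show "integrable lborel (\<lambda>x. K\<^sup>2 / 4 ^ k * indicator ?b x)"
        by (intro integrable_mult_right integrable_real_indicator emeasure_lborel_cball_finite) auto
      show "(norm (Xk k x))\<^sup>2 \<le> K\<^sup>2 / 4 ^ k * indicator ?b x" for x
        using Xk[of k x] Xk0[of x k] by (cases "x \<in> ?b") auto
    qed
    also have "\<dots> = K\<^sup>2 / 4 ^ k * measure lborel ?b" by simp
    also have "measure lborel ?b = \<omega> * (2 ^ Suc k) ^ CARD('n)"
      by (subst content_cball) (auto simp: \<omega>_def)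
    \<comment> \<open>The bound on the dimension enters here: the volume grows at most like the
      fourth power of the radius.\<close>
    also have "K\<^sup>2 / 4 ^ k * (\<omega> * (2 ^ Suc k) ^ CARD('n)) \<le> K\<^sup>2 / 4 ^ k * (\<omega> * (2 ^ Suc k) ^ 4)"
      using \<omega> N by (intro mult_left_mono power_increasing one_le_power) auto
    also have "\<dots> = 16 * K\<^sup>2 * \<omega> * 4 ^ k"
    proof -
      have "((2::real) ^ Suc k) ^ 4 = 16 * (4 ^ k * 4 ^ k)"
        by (simp add: power_mult_distrib flip: power_mult) (simp add: power_mult mult.commute[of k 4] flip: power_mult_distrib)
      then show ?thesis by (simp add: field_simps)
    qed
    finally show ?thesis .
  qed
  define C where "C = 1024 * K\<^sup>2 * B\<^sup>2 * K\<^sup>2 * \<omega>"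
  \<comment> \<open>The next cutoff \<open>\<theta>k (Suc k)\<close> equals 1 on the support of
    \<open>Xk k\<close> and can be inserted for the energy estimate. The factor \<open>4 ^ k\<close>
    then cancels, leaving \<open>16 * 16 * 4 = 1024\<close> in \<open>C\<close>.\<close>
  have energy: "(LINT x|lborel. (norm (U x))\<^sup>2 * (norm (Xk k x))\<^sup>2) \<le> C" for k
  proof -
    have "(LINT x|lborel. (norm (U x))\<^sup>2 * (norm (Xk k x))\<^sup>2)
        \<le> (LINT x|lborel. K\<^sup>2 / 4 ^ k * ((\<theta>k (Suc k) x)\<^sup>2 * (norm (U x))\<^sup>2))"
    proof (rule integral_mono[OF intUX])
      show "integrable lborel (\<lambda>x. K\<^sup>2 / 4 ^ k * ((\<theta>k (Suc k) x)\<^sup>2 * (norm (U x))\<^sup>2))"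
        by (rule integrable_lborel_compact_support[where R="2 ^ Suc (Suc k)"], intro continuous_intros)
          (auto simp: \<theta>k0)
      show "(norm (U x))\<^sup>2 * (norm (Xk k x))\<^sup>2 \<le> K\<^sup>2 / 4 ^ k * ((\<theta>k (Suc k) x)\<^sup>2 * (norm (U x))\<^sup>2)" for x
      proof (cases "norm x \<le> 2 ^ Suc k")
        case True
        have "(norm (U x))\<^sup>2 * (norm (Xk k x))\<^sup>2 \<le> (norm (U x))\<^sup>2 * (K\<^sup>2 / 4 ^ k)"
          by (intro mult_left_mono Xk) simp
        then show ?thesis by (simp add: \<theta>k1[OF True] mult.commute)
      qed (simp add: Xk0)
    qed
    also have "\<dots> = K\<^sup>2 / 4 ^ k * (LINT x|lborel. (\<theta>k (Suc k) x)\<^sup>2 * (norm (U x))\<^sup>2)" by simp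
    also have "\<dots> \<le> K\<^sup>2 / 4 ^ k * (16 * B\<^sup>2 * (LINT x|lborel. (norm (Xk (Suc k) x))\<^sup>2))"
      by (intro mult_left_mono energy_estimate[OF f B \<theta>k, where R="2 ^ Suc (Suc k)"]) (auto simp: \<theta>k0)
    also have "\<dots> \<le> K\<^sup>2 / 4 ^ k * (16 * B\<^sup>2 * (16 * K\<^sup>2 * \<omega> * 4 ^ Suc k))"
      by (intro mult_left_mono dirichlet) auto
    also have "\<dots> = C" by (simp add: C_def)
    finally show ?thesis .
  qed
  show ?thesis
  proof (rule that)
    fix r L :: nat assume L: "L > 0"
    define \<eta> where "\<eta> x = (1 / real L) * (\<Sum>k<L. \<theta>k (r + k) x)" for x
    define E where "E x = (1 / real L) *\<^sub>R (\<Sum>k<L. Xk (r + k) x)" for x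
    have \<eta>: "C1_grad \<eta> E"
      using C1_grad_mult[OF C1_grad_const[of "1 / real L"] C1_grad_sum[of "{..<L}" "\<lambda>k. \<theta>k (r + k)", OF \<theta>k]]
      by (simp add: \<eta>_def[abs_def] E_def[abs_def])
    have supp: "\<eta> x = 0" if "norm x > 2 ^ (r + L)" for x
    proof -
      have "\<theta>k (r + k) x = 0" if "k < L" for k
      proof (rule \<theta>k0)
        have "(2::real) ^ Suc (r + k) \<le> 2 ^ (r + L)"
          using \<open>k < L\<close> by (intro power_increasing) auto
        then show "2 ^ Suc (r + k) \<le> norm x" using \<open>norm x > 2 ^ (r + L)\<close> by linarith
      qed
      then show ?thesis by (simp add: \<eta>_def)
    qed
    have one: "\<eta> x = 1" if "norm x \<le> 2 ^ r" for x
    proof -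
      have "\<theta>k (r + k) x = 1" for k
      proof (rule \<theta>k1)
        have "(2::real) ^ r \<le> 2 ^ (r + k)" by (intro power_increasing) auto
        then show "norm x \<le> 2 ^ (r + k)" using that by linarith
      qed
      then show ?thesis using L by (simp add: \<eta>_def)
    qed
    \<comment> \<open>Each \<open>Xk k\<close> vanishes also on the two spheres bounding its
      annulus, so even adjacent scales do not overlap.\<close>
    have disj: "Xk k x = 0 \<or> Xk l x = 0" if "k < l" for k l x
    proof (cases "norm x \<le> 2 ^ l")
      case False
      have "(2::real) ^ Suc k \<le> 2 ^ l" using that by (intro power_increasing) auto
      then show ?thesis using False Xk0[of x k] by simp
    qed (simp add: Xk0)
    have norm_E: "(norm (E x))\<^sup>2 = (\<Sum>k<L. (norm (Xk (r + k) x))\<^sup>2) / (real L)\<^sup>2" for x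
    proof -
      have "pairwise (\<lambda>i j. orthogonal (Xk (r + i) x) (Xk (r + j) x)) {..<L}"
      proof (rule pairwiseI)
        fix i j :: nat assume "i \<noteq> j"
        then consider "i < j" | "j < i" by linarith
        then have "Xk (r + i) x = 0 \<or> Xk (r + j) x = 0"
          by cases (use disj[of "r + i" "r + j" x] disj[of "r + j" "r + i" x] in auto)
        then show "orthogonal (Xk (r + i) x) (Xk (r + j) x)" by (auto simp: orthogonal_def)
      qed
      from norm_sum_Pythagorean[OF finite_lessThan this] show ?thesis
        by (simp add: E_def power_mult_distrib power_divide)
    qed
    have "(LINT x|lborel. (norm (U x))\<^sup>2 * (norm (E x))\<^sup>2)
      = (LINT x|lborel. (\<Sum>k<L. (norm (U x))\<^sup>2 * (norm (Xk (r + k) x))\<^sup>2) / (real L)\<^sup>2)"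
      by (simp add: norm_E sum_distrib_left)
    also have "\<dots> = (\<Sum>k<L. LINT x|lborel. (norm (U x))\<^sup>2 * (norm (Xk (r + k) x))\<^sup>2) / (real L)\<^sup>2"
      using intUX by simp
    also have "\<dots> \<le> (\<Sum>k<L. C) / (real L)\<^sup>2"
      by (intro divide_right_mono sum_mono energy) simp
    also have "\<dots> = C / real L" using L by (simp add: power2_eq_square)
    finally have "(LINT x|lborel. (norm (U x))\<^sup>2 * (norm (E x))\<^sup>2) \<le> C / real L" .
    then show "\<exists>\<eta> E R. C1_grad \<eta> E \<and> (\<forall>x. norm x > R \<longrightarrow> \<eta> x = 0)
      \<and> (\<forall>x. norm x \<le> 2 ^ r \<longrightarrow> \<eta> x = 1)
      \<and> (LINT x|lborel. (norm (U x))\<^sup>2 * (norm (E x))\<^sup>2) \<le> C / real L"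
      using \<eta> supp one by blast
  qed
qed

text \<open>This exhibits the Sternberg-Zumbrun integrand as a sum of squares, which vanishes only
  if all rows of the Hessian are multiples of one vector, with the components of \<open>U x\<close>
  as coefficients.\<close>

lemma gram_identity:
  assumes "U x \<noteq> 0"
  shows "(\<Sum>i\<in>UNIV. (norm (A i x - U x $ i *\<^sub>R (hess_grad x /\<^sub>R (norm (U x))\<^sup>2)))\<^sup>2)
    = (\<Sum>i\<in>UNIV. (norm (A i x))\<^sup>2) - (norm (hess_grad x))\<^sup>2 / (norm (U x))\<^sup>2"
proof -
  have W: "(\<Sum>i\<in>UNIV. (U x $ i)\<^sup>2) = (norm (U x))\<^sup>2"
    unfolding power2_norm_eq_inner inner_vec_def by (simp add: power2_eq_square)
  show ?thesis
    using weighted_sum_norm_square[of UNIV "\<lambda>i. U x $ i" "\<lambda>i. A i x"] assms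
    by (simp add: W hess_grad_def)
qed

text \<open>If the integrand \<open>D\<close> were positive at \<open>x\<close>, it would stay above
  \<open>D x / 2\<close> on a ball, contributing a fixed \<open>c > 0\<close> to the left of the
  stability inequality; the right-hand side is made smaller than \<open>c\<close> by letting first
  \<open>\<epsilon>\<close> tend to 0 and then \<open>L\<close> to infinity.\<close>

lemma hessian_rank_one:
  assumes f: "\<And>t. f t \<ge> 0" and B: "\<And>x. \<bar>u x\<bar> \<le> B" and N: "CARD('n) \<le> 4"
    and x: "U x \<noteq> 0"
  shows "A i x = U x $ i *\<^sub>R (hess_grad x /\<^sub>R (norm (U x))\<^sup>2)"
proof -
  \<comment> \<open>Where \<open>U y = 0\<close> the quotient is 0 by the convention on division, so
    \<open>D\<close> is nonnegative there too; \<open>D_le\<close> persists since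
    \<open>hess_grad y\<close> also vanishes.\<close>
  define D where "D y = (\<Sum>i\<in>UNIV. (norm (A i y))\<^sup>2) - (norm (hess_grad y))\<^sup>2 / (norm (U y))\<^sup>2" for y
  have D_nonneg: "D y \<ge> 0" for y
  proof (cases "U y = 0")
    case False
    show ?thesis unfolding D_def gram_identity[OF False, symmetric] by (intro sum_nonneg) simp
  qed (simp add: D_def sum_nonneg)
  have D_le: "D y \<le> (\<Sum>i\<in>UNIV. (norm (A i y))\<^sup>2) - (norm (hess_grad y))\<^sup>2 / ((norm (U y))\<^sup>2 + \<epsilon>)" if "\<epsilon> > 0" for y \<epsilon>
  proof (cases "U y = 0")
    case True
    then show ?thesis by (simp add: D_def hess_grad_def)
  next
    case False
    then show ?thesis using that unfolding D_def
      by (intro diff_left_mono divide_left_mono mult_pos_pos add_pos_pos) auto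
  qed
  have "D x \<le> 0"
  proof (rule ccontr)
    assume "\<not> D x \<le> 0"
    then have Dx: "D x > 0" by simp
    have "isCont D x"
    proof -
      have "continuous_on {y. U y \<noteq> 0} D"
        unfolding D_def by (intro continuous_intros) auto
      moreover have "open {y. U y \<noteq> 0}"
        by (intro open_Collect_neq continuous_intros)
      ultimately show ?thesis using x by (simp add: continuous_on_eq_continuous_at)
    qed
    then obtain \<delta> where \<delta>: "\<delta> > 0" and near: "\<And>y. dist y x < \<delta> \<Longrightarrow> \<bar>D y - D x\<bar> < D x / 2"
      using Dx unfolding continuous_at_eps_delta dist_real_def by (metis half_gt_zero)
    \<comment> \<open>With this \<open>r\<close> every cutoff equals 1 on the ball around
      \<open>x\<close>.\<close>
    obtain r where r: "norm x + \<delta> < 2 ^ r"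
      using real_arch_pow[of 2 "norm x + \<delta>"] by auto
    define c where "c = D x / 2 * measure lborel (ball x \<delta>)"
    have c: "c > 0" using Dx \<delta> by (simp add: c_def)
    obtain C where C: "\<And>r L. L > 0 \<Longrightarrow> \<exists>\<eta> E R. C1_grad \<eta> E \<and> (\<forall>x. norm x > R \<longrightarrow> \<eta> x = 0)
      \<and> (\<forall>x. norm x \<le> 2 ^ r \<longrightarrow> \<eta> x = 1)
      \<and> (LINT x|lborel. (norm (U x))\<^sup>2 * (norm (E x))\<^sup>2) \<le> C / real L"
      by (rule cutoff_energy[OF f B N]) blast
    have bound: "c \<le> C / real L" if L: "L > 0" for L
    proof -
      obtain \<eta> E R where \<eta>: "C1_grad \<eta> E" and supp: "\<And>x. norm x > R \<Longrightarrow> \<eta> x = 0"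
        and one: "\<And>x. norm x \<le> 2 ^ r \<Longrightarrow> \<eta> x = 1"
        and en: "(LINT x|lborel. (norm (U x))\<^sup>2 * (norm (E x))\<^sup>2) \<le> C / real L"
        using C[OF L, of r] by blast
      note [continuous_intros] = continuous_on_compose2[OF C1_grad_cont[OF \<eta>] _ subset_UNIV]
      \<comment> \<open>\<open>M\<close> has no known sign and depends on the cutoff, hence on
        \<open>L\<close>; therefore \<open>\<epsilon>\<close> goes to 0 while \<open>L\<close> is
        fixed.\<close>
      define M where "M = (LINT x|lborel. (norm (E x))\<^sup>2) - (LINT x|lborel. f' (u x) * (\<eta> x)\<^sup>2)"
      have eps: "c \<le> C / real L + \<epsilon> * M" if \<epsilon>: "\<epsilon> > 0" for \<epsilon>
      proof -
        let ?D = "\<lambda>y. (\<Sum>i\<in>UNIV. (norm (A i y))\<^sup>2) - (norm (hess_grad y))\<^sup>2 / ((norm (U y))\<^sup>2 + \<epsilon>)"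
        have nz: "(norm (U y))\<^sup>2 + \<epsilon> \<noteq> 0" for y
          using \<epsilon> by (simp add: add_nonneg_eq_0_iff)
        have "c = (LINT y|lborel. D x / 2 * indicator (ball x \<delta>) y)" by (simp add: c_def)
        also have "\<dots> \<le> (LINT y|lborel. ?D y * (\<eta> y)\<^sup>2)"
        proof (rule integral_mono)
          show "integrable lborel (\<lambda>y. D x / 2 * indicator (ball x \<delta>) y)"
            by (intro integrable_mult_right integrable_real_indicator emeasure_lborel_ball_finite) auto
          show "integrable lborel (\<lambda>y. ?D y * (\<eta> y)\<^sup>2)"
            by (rule integrable_lborel_compact_support[where R=R], intro continuous_intros)
              (simp_all add: supp nz)
          show "D x / 2 * indicator (ball x \<delta>) y \<le> ?D y * (\<eta> y)\<^sup>2" for y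
          proof (cases "y \<in> ball x \<delta>")
            case True
            then have d: "dist y x < \<delta>" by (simp add: dist_commute)
            have "norm y \<le> norm x + dist y x"
              by (metis add.commute dist_norm norm_triangle_sub)
            then have "\<eta> y = 1" using d r by (intro one) linarith
            moreover have "D x / 2 \<le> ?D y" using near[OF d] D_le[OF \<epsilon>, of y] by linarith
            ultimately show ?thesis using True by simp
          next
            case False
            then show ?thesis using D_nonneg[of y] D_le[OF \<epsilon>, of y] by simp
          qed
        qed
        also have "\<dots> \<le> (LINT x|lborel. (norm (U x))\<^sup>2 * (norm (E x))\<^sup>2) + \<epsilon> * M"
          unfolding M_def by (rule stability_gradient[OF \<eta> supp \<epsilon>])
        also have "\<dots> \<le> C / real L + \<epsilon> * M" using en by simp
        finally show ?thesis .
      qed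
      show ?thesis
      proof (rule field_le_epsilon)
        fix e :: real assume e: "e > 0"
        have "e / (\<bar>M\<bar> + 1) * M \<le> e / (\<bar>M\<bar> + 1) * (\<bar>M\<bar> + 1)"
          using e by (intro mult_left_mono) auto
        also have "\<dots> = e" by simp
        finally show "c \<le> C / real L + e" using eps[of "e / (\<bar>M\<bar> + 1)"] e by fastforce
      qed
    qed
    obtain L :: nat where "C / c < real L" using reals_Archimedean2 by blast
    then have L: "C / c < real (Suc L)" by simp
    have "c * real (Suc L) \<le> C" using bound[of "Suc L"] by (simp add: field_simps)
    moreover have "C < c * real (Suc L)" using L c by (simp add: field_simps)
    ultimately show False by simp
  qed
  then have "(\<Sum>i\<in>UNIV. (norm (A i x - U x $ i *\<^sub>R (hess_grad x /\<^sub>R (norm (U x))\<^sup>2)))\<^sup>2) = 0"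
    using D_nonneg[of x] unfolding gram_identity[OF x] D_def by simp
  then show ?thesis by (simp add: sum_nonneg_eq_0_iff)
qed

section \<open>The gradient along the ray of steepest descent\<close>

text \<open>By the rank-one form all components of \<open>V\<close> satisfy the same scalar linear
  equation along the ray, with coefficient \<open>a s \<bullet> (- p)\<close>, so \<open>V\<close>
  stays parallel to \<open>p\<close>. Its component along \<open>p\<close> then grows because the
  Laplacian is nonpositive.\<close>

lemma gradient_along_line:
  assumes f: "\<And>t. f t \<ge> 0" and B: "\<And>x. \<bar>u x\<bar> \<le> B" and N: "CARD('n) \<le> 4"
    and nz: "\<And>s. 0 \<le> s \<Longrightarrow> s \<le> t \<Longrightarrow> U (x + s *\<^sub>R (- U x)) \<noteq> 0" and t: "t \<ge> 0"
  shows "(norm (U x))\<^sup>2 \<le> U (x + t *\<^sub>R (- U x)) \<bullet> U x"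
proof -
  define p where "p = U x"
  define V where "V s = U (x + s *\<^sub>R (- p))" for s
  define a where "a s = hess_grad (x + s *\<^sub>R (- p)) /\<^sub>R (norm (V s))\<^sup>2" for s
  define h where "h s = (\<Sum>i\<in>UNIV. V s $ i * p $ i)" for s
  define W where "W s = (\<Sum>i\<in>UNIV. V s $ i * V s $ i)" for s
  have h_eq: "h s = V s \<bullet> p" and W_eq: "W s = V s \<bullet> V s" for s
    by (simp_all add: h_def W_def inner_vec_def)
  have V0: "V 0 = p" by (simp add: V_def p_def)
  have p: "p \<noteq> 0" using nz[of 0] t by (simp add: p_def)
  have Vnz: "V s \<noteq> 0" if "0 \<le> s" "s \<le> t" for s
    using nz[OF that] by (simp add: V_def p_def)
  have A_eq: "A i (x + s *\<^sub>R (- p)) = V s $ i *\<^sub>R a s" if "0 \<le> s" "s \<le> t" for s i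
    using hessian_rank_one[OF f B N, of "x + s *\<^sub>R (- p)" i] Vnz[OF that]
    by (simp add: V_def a_def)
  have dV: "((\<lambda>s. V s $ i) has_real_derivative A i (x + s *\<^sub>R (- p)) \<bullet> (- p)) (at s)" for s i
    unfolding V_def by (rule C1_grad_line[OF U_C1])
  have dh: "(h has_real_derivative (a s \<bullet> (- p)) * h s) (at s)" if "0 \<le> s" "s \<le> t" for s
  proof -
    have "(h has_real_derivative (\<Sum>i\<in>UNIV. (A i (x + s *\<^sub>R (- p)) \<bullet> (- p)) * p $ i)) (at s)"
      unfolding h_def[abs_def] by (intro DERIV_sum DERIV_cmult_right dV)
    then show ?thesis
      unfolding A_eq[OF that] by (simp add: h_def sum_distrib_left mult_ac)
  qed
  have dW: "(W has_real_derivative 2 * (a s \<bullet> (- p)) * W s) (at s)" if "0 \<le> s" "s \<le> t" for s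
  proof -
    have "(W has_real_derivative (\<Sum>i\<in>UNIV. (A i (x + s *\<^sub>R (- p)) \<bullet> (- p)) * V s $ i
        + (A i (x + s *\<^sub>R (- p)) \<bullet> (- p)) * V s $ i)) (at s)"
      unfolding W_def[abs_def] by (intro DERIV_sum DERIV_mult dV)
    then show ?thesis
      unfolding A_eq[OF that] by (simp add: W_def sum_distrib_left mult_ac flip: mult_2)
  qed
  have Wpos: "W s > 0" if "0 \<le> s" "s \<le> t" for s
    using Vnz[OF that] by (simp add: W_eq)
  \<comment> \<open>Since \<open>h\<close> grows at the logarithmic rate
    \<open>a s \<bullet> (- p)\<close> and \<open>W\<close> at twice that rate, the quotient is
    constant. Its value at 0 is the equality case of Cauchy-Schwarz, which gives parallelism without
    solving the equation.\<close>
  have ratio: "(h s)\<^sup>2 / W s = p \<bullet> p" if s: "0 \<le> s" "s \<le> t" for s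
  proof -
    have d: "((\<lambda>s. (h s)\<^sup>2 / W s) has_real_derivative 0) (at r)" if "0 \<le> r" "r \<le> s" for r
    proof -
      have r: "0 \<le> r" "r \<le> t" using that s by auto
      have "W r \<noteq> 0" using Wpos[OF r] by simp
      then show ?thesis
        by (auto intro!: derivative_eq_intros dh[OF r] dW[OF r] simp: power2_eq_square algebra_simps)
    qed
    have "(h 0)\<^sup>2 / W 0 \<le> (h s)\<^sup>2 / W s"
      by (rule DERIV_nonneg_imp_nondecreasing[OF s(1)]) (use d in blast)
    moreover have "(h s)\<^sup>2 / W s \<le> (h 0)\<^sup>2 / W 0"
      by (rule DERIV_nonpos_imp_nonincreasing[OF s(1)]) (use d in blast)
    moreover have "(h 0)\<^sup>2 / W 0 = p \<bullet> p"
      using p by (simp add: h_eq W_eq V0 power2_eq_square)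
    ultimately show ?thesis by linarith
  qed
  have parallel: "(p \<bullet> p) *\<^sub>R V s = h s *\<^sub>R p" if s: "0 \<le> s" "s \<le> t" for s
  proof -
    have "(norm ((p \<bullet> p) *\<^sub>R V s - h s *\<^sub>R p))\<^sup>2 = (p \<bullet> p) * ((p \<bullet> p) * W s - (h s)\<^sup>2)"
      unfolding power2_norm_eq_inner W_eq
      by (simp add: inner_diff_left inner_diff_right inner_commute[of p "V s"] power2_eq_square algebra_simps
          flip: h_eq)
    also have "\<dots> = 0" using ratio[OF s] Wpos[OF s] by (simp add: field_simps)
    finally show ?thesis by simp
  qed
  have "h 0 \<le> h t"
  proof (rule DERIV_nonneg_imp_nondecreasing[OF t])
    fix s assume s: "0 \<le> s" "s \<le> t"
    have "a s \<bullet> V s = (\<Sum>i\<in>UNIV. A i (x + s *\<^sub>R (- p)) $ i)"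
      unfolding A_eq[OF s] by (simp add: inner_vec_def mult.commute)
    then have "a s \<bullet> V s \<le> 0" using pde[of "x + s *\<^sub>R (- p)"] f by simp
    \<comment> \<open>Parallelism trades \<open>h s *\<^sub>R p\<close> for a multiple of
      \<open>V s\<close>, and \<open>a s \<bullet> V s\<close> is the Laplacian of
      \<open>u\<close>.\<close>
    moreover have "(a s \<bullet> (- p)) * h s = - (a s \<bullet> (h s *\<^sub>R p))" by simp
    then have "(a s \<bullet> (- p)) * h s = - (p \<bullet> p) * (a s \<bullet> V s)"
      unfolding parallel[OF s, symmetric] by simp
    ultimately have "(a s \<bullet> (- p)) * h s \<ge> 0" by (simp add: mult_nonneg_nonpos)
    then show "\<exists>y. (h has_real_derivative y) (at s) \<and> 0 \<le> y" using dh[OF s] by blast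
  qed
  then show ?thesis
    by (simp add: h_eq V0 power2_norm_eq_inner) (simp add: V_def p_def)
qed

text \<open>Before a first zero \<open>s\<close> of the gradient on the ray, the previous bound
  keeps \<open>V r \<bullet> U x\<close> at least \<open>(norm (U x))\<^sup>2\<close>, which
  contradicts continuity at \<open>s\<close>.\<close>

lemma gradient_along_line_nonzero:
  assumes f: "\<And>t. f t \<ge> 0" and B: "\<And>x. \<bar>u x\<bar> \<le> B" and N: "CARD('n) \<le> 4"
    and x: "U x \<noteq> 0" and t: "t \<ge> 0"
  shows "U (x + t *\<^sub>R (- U x)) \<noteq> 0"
proof
  define V where "V s = U (x + s *\<^sub>R (- U x))" for s
  assume "U (x + t *\<^sub>R (- U x)) = 0"
  then have Vt: "V t = 0" by (simp add: V_def)
  have V: "continuous_on T V" for T unfolding V_def by (intro continuous_intros)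
  define Z where "Z = {0..t} \<inter> {s. V s = 0}"
  have "compact Z"
    unfolding Z_def by (intro compact_Int_closed closed_Collect_eq V continuous_on_const compact_Icc)
  moreover have "Z \<noteq> {}" using Vt t by (auto simp: Z_def)
  ultimately obtain s where s: "s \<in> Z" and min: "\<And>r. r \<in> Z \<Longrightarrow> s \<le> r"
    by (metis compact_attains_inf)
  have Vs: "V s = 0" and s0: "0 \<le> s" "s \<le> t" using s by (auto simp: Z_def)
  have "s \<noteq> 0" using x Vs by (auto simp: V_def)
  then have "s > 0" using s0 by simp
  have low: "(norm (U x))\<^sup>2 \<le> V r \<bullet> U x" if "0 \<le> r" "r < s" for r
    unfolding V_def
  proof (rule gradient_along_line[OF f B N _ that(1)])
    show "U (x + q *\<^sub>R (- U x)) \<noteq> 0" if "0 \<le> q" "q \<le> r" for q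
      using min[of q] that \<open>r < s\<close> s0 by (force simp: Z_def V_def)
  qed
  have "continuous (at s) (\<lambda>r. V r \<bullet> U x)"
    using V[of UNIV] by (auto intro!: continuous_intros simp: continuous_on_eq_continuous_at)
  moreover have "(norm (U x))\<^sup>2 > 0" using x by simp
  ultimately obtain d where d: "d > 0"
    and near: "\<And>r. dist r s < d \<Longrightarrow> dist (V r \<bullet> U x) (V s \<bullet> U x) < (norm (U x))\<^sup>2"
    unfolding continuous_at_eps_delta by blast
  define r where "r = max 0 (s - d / 2)"
  have "0 \<le> r" "r < s" "dist r s < d" using d \<open>s > 0\<close> by (auto simp: r_def dist_real_def)
  then show False using low[of r] near[of r] Vs by (simp add: dist_real_def)
qed

text \<open>Along the ray \<open>u\<close> decreases at rate at least \<open>c\<close>. The length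
  \<open>T\<close> makes it drop by \<open>2 * B + 1\<close>, more than its oscillation
  allows.\<close>

lemma gradient_eq_0:
  assumes f: "\<And>t. f t \<ge> 0" and B: "\<And>x. \<bar>u x\<bar> \<le> B" and N: "CARD('n) \<le> 4"
  shows "U x = 0"
proof (rule ccontr)
  assume x: "U x \<noteq> 0"
  define c where "c = (norm (U x))\<^sup>2"
  have c: "c > 0" using x by (simp add: c_def)
  define T where "T = (2 * B + 1) / c"
  have "B \<ge> 0" using B[of 0] by linarith
  then have T: "T \<ge> 0" using c by (simp add: T_def)
  have "u (x + T *\<^sub>R (- U x)) + c * T \<le> u (x + 0 *\<^sub>R (- U x)) + c * 0"
  proof (rule DERIV_nonpos_imp_nonincreasing[OF T])
    fix s assume "0 \<le> s" "s \<le> T"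
    then have "c \<le> U (x + s *\<^sub>R (- U x)) \<bullet> U x"
      unfolding c_def
      by (intro gradient_along_line[OF f B N] gradient_along_line_nonzero[OF f B N x])
    then show "\<exists>y. ((\<lambda>s. u (x + s *\<^sub>R (- U x)) + c * s) has_real_derivative y) (at s) \<and> y \<le> 0"
      by (intro exI[of _ "U (x + s *\<^sub>R (- U x)) \<bullet> (- U x) + c * 1"] conjI DERIV_add C1_grad_line[OF u_C1]
          DERIV_cmult DERIV_ident) simp
  qed
  moreover have "c * T = 2 * B + 1" using c by (simp add: T_def)
  ultimately show False using B[of x] B[of "x + T *\<^sub>R (- U x)"] by simp
qed

end

section \<open>From the classical formulation to gradients, and the conclusion\<close>

theorem theorem1p1:
  fixes f :: "real \<Rightarrow> real" and u :: "real ^ 'n \<Rightarrow> real"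
  assumes "1 \<le> CARD('n)" and "CARD('n) \<le> 4"
    and "f C1_differentiable_on UNIV"
    and "\<forall>t. f t \<ge> 0"
    and "stable_solution f u"
    and "bounded (range u)"
  shows "u constant_on UNIV"
proof -
  have sol: "Ck 2 u" "\<And>x. - laplacian u x = f (u x)"
    and stab: "\<And>\<phi>. C1_compact_support \<phi> \<Longrightarrow>
      (LINT x|lborel. deriv f (u x) * (\<phi> x)\<^sup>2) \<le> (LINT x|lborel. (norm (gradient \<phi> x))\<^sup>2)"
    using assms(5) by (auto simp: stable_solution_def solution_def)
  obtain f' where f': "\<And>t. (f has_real_derivative f' t) (at t)" "continuous_on UNIV f'"
    using assms(3) unfolding C1_differentiable_on_def has_real_derivative_iff_has_vector_derivative by auto
  have deriv_f: "deriv f = f'" using f'(1) DERIV_imp_deriv by blast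
  have Ck: "\<And>x. u differentiable (at x)" "\<And>i. Ck 1 (partial_deriv i u)"
    using sol(1) by (auto simp: numeral_2_eq_2 One_nat_def)
  have U: "C1_grad (\<lambda>x. gradient u x $ i) (gradient (partial_deriv i u))" for i
    using Ck_1_imp_C1_grad[OF Ck(2)[of i]] by (simp add: gradient_def)
  have "continuous_on UNIV (partial_deriv i u)" for i
    using C1_grad_cont[OF U[of i]] by (simp add: gradient_def)
  then have u: "C1_grad u (gradient u)"
    using Ck(1) by (intro Ck_1_imp_C1_grad) (simp add: One_nat_def)
  \<comment> \<open>Twice applying the passage from \<open>Ck 1\<close> to gradients yields the
    gradient and the Hessian rows; stability transfers because a function vanishing outside a ball
    has compact support.\<close>
  interpret stable_semilinear f f' u "gradient u" "\<lambda>i. gradient (partial_deriv i u)"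
  proof unfold_locales
    show "(\<Sum>i\<in>UNIV. gradient (partial_deriv i u) x $ i) = - f (u x)" for x
      using sol(2)[of x] by (simp add: laplacian_def gradient_def)
    show "(LINT x|lborel. f' (u x) * (\<xi> x)\<^sup>2) \<le> (LINT x|lborel. (norm (\<Xi> x))\<^sup>2)"
      if "C1_grad \<xi> \<Xi>" "\<And>x. norm x > R \<Longrightarrow> \<xi> x = 0" for \<xi> \<Xi> R
      using stab[OF C1_compact_supportI[OF that]] by (simp add: C1_grad_gradient[OF that(1)] deriv_f)
  qed (use f' u U in auto)
  obtain B where B: "\<And>x. \<bar>u x\<bar> \<le> B"
    using assms(6) by (auto simp: bounded_iff)
  have "gradient u x = 0" for x
    using gradient_eq_0 assms(2,4) B by blast
  then have "\<exists>c. \<forall>x\<in>UNIV. u x = c"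
    using C1_grad_deriv[OF u] by (intro has_derivative_zero_constant) auto
  then show ?thesis by (auto simp: constant_on_def)
qed

end
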